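(* Let $p$ be a prime, let $G$ be a finite non-abelian $p$-group and let $n\geq 2$. Suppose $Aut_{c}^{n-1}(G)=Autcent(G)$. Then: (1) $\gamma_n(G) \leq Z(G)$ and $d(\gamma_n(G)) = d(Z(G))$. (2) If $exp(G/\gamma_2(G))>var(\gamma_{n}(G),Z(G))$, then $\gamma_{n}(G)=Z(G)$ and $Aut_{c}^{n-1}(G)$ is isomorphic to $Hom(G/Z(G), \gamma_n(G))$. Conversely, if $\gamma_{n}(G)=Z(G)$ and $Aut_{c}^{n-1}(G)$ is isomorphic to $Hom(G/Z(G), \gamma_n(G))$, then $Aut_{c}^{n-1}(G)=Autcent(G)$ and $exp(G/\gamma_2(G))>var(\gamma_{n}(G),Z(G))$.
   Context: $Z(G)$ is the center of $G$ and $\gamma_n(G)$ is the $n$-th term of the lower central series, with $\gamma_1(G)=G$. $Autcent(G)$ is the group of central automorphisms of $G$, i.e. automorphisms $\alpha$ with $g^{-1}\alpha(g)\in Z(G)$ for all $g \in G$. For $m \geq 1$, $Aut_{c}^{m}(G)$ is the group of all automorphisms $\beta$ of $G$ such that for each $g\in G$ there exists $x\in \gamma_{m}(G)$ (depending on $g$) with $\beta(g)= x^{-1}gx$. $exp(K)$ is the exponent of a group $K$ (the smallest positive integer $e$ with $g^e=1$ for all $g\in K$), and $d(K)$ is the rank of a finite abelian group $K$. For an abelian group $B$, $Hom(K,B)$ is the abelian group of homomorphisms from $K$ to $B$. Definition of $var$: let $A \leq B$ be finite abelian $p$-groups with $d(A)=d(B)=t$ and cyclic decompositions $A = C_{p^{n_1}}\times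 \cdots \times C_{p^{n_t}}$, $B = C_{p^{m_1}}\times \cdots \times C_{p^{m_t}}$, where $n_i\geq n_{i+1}$ and $m_j\geq m_{j+1}$ are positive integers and $C_{p^i}$ is the cyclic group of order $p^i$. If $A$ is a proper subgroup of $B$, there is a unique integer $r$ such that $n_r<m_r$ and $n_j=m_j$ for all $r+1\leq j\leq t$, and one sets $var(A,B)=p^{n_r}$. If $A=B$, one sets $var(A,B)=1$. (In part (2), $var(\gamma_n(G),Z(G))$ makes sense because of part (1).) *)

theory Defs
  imports "HOL-Algebra.Bij" "HOL-Algebra.Product_Groups" "HOL-Computational_Algebra.Primes"
begin

definition p_group :: "nat \<Rightarrow> ('a, 'b) monoid_scheme \<Rightarrow> bool" where
  "p_group p G \<longleftrightarrow> group G \<and> finite (carrier G) \<and> (\<exists>k. order G = p ^ k)"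

definition center :: "('a, 'b) monoid_scheme \<Rightarrow> 'a set" where
  "center G = {z \<in> carrier G. \<forall>g \<in> carrier G. z \<otimes>\<^bsub>G\<^esub> g = g \<otimes>\<^bsub>G\<^esub> z}"

definition commutator :: "('a, 'b) monoid_scheme \<Rightarrow> 'a \<Rightarrow> 'a \<Rightarrow> 'a" where
  "commutator G x y = inv\<^bsub>G\<^esub> x \<otimes>\<^bsub>G\<^esub> inv\<^bsub>G\<^esub> y \<otimes>\<^bsub>G\<^esub> x \<otimes>\<^bsub>G\<^esub> y"

text \<open>The numbering of the lower central series starts at 1; index 0 carries no information
  and is mapped to the whole group to make the function total.\<close>

fun lower_central :: "('a, 'b) monoid_scheme \<Rightarrow> nat \<Rightarrow> 'a set" where
  "lower_central G 0 = carrier G"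
| "lower_central G (Suc 0) = carrier G"
| "lower_central G (Suc (Suc k)) =
     generate G {commutator G x y | x y. x \<in> lower_central G (Suc k) \<and> y \<in> carrier G}"

definition Autcent :: "('a, 'b) monoid_scheme \<Rightarrow> ('a \<Rightarrow> 'a) set" where
  "Autcent G = {\<alpha> \<in> auto G. \<forall>g \<in> carrier G. inv\<^bsub>G\<^esub> g \<otimes>\<^bsub>G\<^esub> \<alpha> g \<in> center G}"

definition Autc :: "('a, 'b) monoid_scheme \<Rightarrow> nat \<Rightarrow> ('a \<Rightarrow> 'a) set" where
  "Autc G m = {\<beta> \<in> auto G. \<forall>g \<in> carrier G. \<exists>x \<in> lower_central G m.
                 \<beta> g = inv\<^bsub>G\<^esub> x \<otimes>\<^bsub>G\<^esub> g \<otimes>\<^bsub>G\<^esub> x}"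

definition exponent :: "('a, 'b) monoid_scheme \<Rightarrow> nat" where
  "exponent K = (LEAST e. 0 < e \<and> (\<forall>g \<in> carrier K. g [^]\<^bsub>K\<^esub> e = \<one>\<^bsub>K\<^esub>))"

definition rank :: "('a, 'b) monoid_scheme \<Rightarrow> nat" where
  "rank K = (LEAST d. \<exists>S. S \<subseteq> carrier K \<and> finite S \<and> card S = d \<and> generate K S = carrier K)"

text \<open>As for \<^const>\<open>auto\<close>, homomorphisms are taken extensional, so that functions differing
  only outside the carrier are not counted as different elements.\<close>

definition Hom_group ::
    "('a, 'c) monoid_scheme \<Rightarrow> ('b, 'd) monoid_scheme \<Rightarrow> ('a \<Rightarrow> 'b) monoid" where
  "Hom_group K B =
     \<lparr>carrier = hom K B \<inter> extensional (carrier K),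
      monoid.mult = (\<lambda>f g. \<lambda>x \<in> carrier K. f x \<otimes>\<^bsub>B\<^esub> g x),
      one = (\<lambda>x \<in> carrier K. \<one>\<^bsub>B\<^esub>)\<rparr>"

definition cyclic_decomposition :: "nat \<Rightarrow> ('a, 'b) monoid_scheme \<Rightarrow> nat list \<Rightarrow> bool" where
  "cyclic_decomposition p A ns \<longleftrightarrow>
     sorted_wrt (\<ge>) ns \<and> (\<forall>k \<in> set ns. 0 < k) \<and>
     A \<cong> product_group {..<length ns} (\<lambda>i. integer_mod_group (p ^ (ns ! i)))"

text \<open>A finite abelian \<open>p\<close>-group has exactly one list of exponents as above, so the choice
  operator merely names it.\<close>

definition cyclic_exponents :: "nat \<Rightarrow> ('a, 'b) monoid_scheme \<Rightarrow> nat list" where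
  "cyclic_exponents p A = (SOME ns. cyclic_decomposition p A ns)"

text \<open>Only meaningful if \<open>A\<close> and \<open>B\<close> are subgroups of \<open>G\<close> with \<open>A \<subseteq> B\<close>, both abelian
  \<open>p\<close>-groups and of the same rank. List positions start at 0, so position \<open>r\<close> below is
  the index \<open>r + 1\<close> of the usual notation.\<close>

definition var :: "nat \<Rightarrow> ('a, 'b) monoid_scheme \<Rightarrow> 'a set \<Rightarrow> 'a set \<Rightarrow> nat" where
  "var p G A B =
     (if A = B then 1
      else let ns = cyclic_exponents p (G\<lparr>carrier := A\<rparr>);
               ms = cyclic_exponents p (G\<lparr>carrier := B\<rparr>);
               r = (THE r. r < length ns \<and> ns ! r < ms ! r \<and>
                           (\<forall>j. r < j \<and> j < length ns \<longrightarrow> ns ! j = ms ! j))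
           in p ^ (ns ! r))"

end

theory Submission
  imports Defs "HOL-Algebra.Multiplicative_Group" "HOL-Algebra.SndIsomorphismGrp"
begin

text \<open>
  An automorphism in \<open>Autc G (n - 1)\<close> moves every \<open>g\<close> by an element of \<open>\<gamma>\<^sub>n\<close>, so if
  \<open>Autc G (n - 1) = Autcent G\<close>, every central automorphism does. Given a central \<open>z\<close> of order
  \<open>p\<close>, we have \<open>\<gamma>\<^sub>2 Z \<noteq> G\<close> because \<open>G\<close> is nilpotent and non-abelian, and a character of
  \<open>G / \<gamma>\<^sub>2 Z\<close> yields a central automorphism sending some \<open>q\<close> to \<open>q z\<close>; hence
  \<open>\<Omega>\<^sub>1(Z) \<subseteq> \<gamma>\<^sub>n\<close>, and the ranks agree. Consequently \<open>G\<close> has no abelian direct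
  factor, and the same construction with characters of \<open>G / \<gamma>\<^sub>2\<close>, which is of exponent at
  most \<open>p ^ k\<close>, gives \<open>\<Omega>\<^sub>k(Z) \<subseteq> \<gamma>\<^sub>n\<close>. If \<open>\<gamma>\<^sub>n \<noteq> Z\<close>, comparing the cyclic decompositions
  through the sizes of \<open>\<Omega>\<^sub>j\<close> then shows \<open>p ^ k \<le> var\<close>. If \<open>\<gamma>\<^sub>n = Z\<close>, the map
  \<open>\<alpha> \<mapsto> (g \<mapsto> g\<^sup>-\<^sup>1 \<alpha>(g))\<close> identifies \<open>Autcent G\<close> with \<open>Hom(G / Z, Z)\<close>, and the converse is a
  matter of counting.
\<close>

section \<open>Finite abelian p-groups\<close>

lemma pow_product_group:
  fixes m :: nat
  assumes "x \<in> carrier (product_group I F)"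
  shows "x [^]\<^bsub>product_group I F\<^esub> m = (\<lambda>i\<in>I. x i [^]\<^bsub>F i\<^esub> m)"
  by (induction m) (auto simp: nat_pow_0 fun_eq_iff)

text \<open>Separating the factor at index 0 from the rest is what later puts a new exponent at the
  head of a list.\<close>

lemma product_group_Suc:
  "F 0 \<times>\<times> product_group {..<n} (\<lambda>i. F (Suc i)) \<cong> product_group {..<Suc n} F"
proof (rule is_isoI[OF group_isomorphisms_imp_iso])
  let ?f = "\<lambda>(x, y). \<lambda>i\<in>{..<Suc n}. case i of 0 \<Rightarrow> x | Suc j \<Rightarrow> y j"
  let ?g = "\<lambda>x. (x 0, \<lambda>i\<in>{..<n}. x (Suc i))"
  show "group_isomorphisms (F 0 \<times>\<times> product_group {..<n} (\<lambda>i. F (Suc i))) (product_group {..<Suc n} F) ?f ?g"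
    unfolding group_isomorphisms_def
    by (auto simp: hom_def fun_eq_iff PiE_iff extensional_def Pi_iff split: nat.splits)
qed

section \<open>Splitting off a cyclic subgroup of maximal order\<close>

lemma (in group) subset_set_mult:
  assumes "subgroup H G" "subgroup K G"
  shows "H \<subseteq> H <#> K" "K \<subseteq> H <#> K"
proof -
  have "x \<in> H <#> K" if "x \<in> H" for x
    using that assms subgroup.one_closed[OF assms(2)] subgroup.mem_carrier[OF assms(1) that]
    unfolding set_mult_def by force
  moreover have "x \<in> H <#> K" if "x \<in> K" for x
    using that assms subgroup.one_closed[OF assms(1)] subgroup.mem_carrier[OF assms(2) that]
    unfolding set_mult_def by force
  ultimately show "H \<subseteq> H <#> K" "K \<subseteq> H <#> K" by auto
qed

text \<open>By Bezout, \<open>y\<close> is a product of powers of \<open>y [^] i\<close> and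
  \<open>y [^] j\<close>. With \<open>j = p\<close> this shows that an exponent \<open>i\<close>
  bringing \<open>y\<close> into a subgroup that contains \<open>y [^] p\<close> but not
  \<open>y\<close> must be divisible by \<open>p\<close>.\<close>

lemma (in group) subgroup_coprime_int_pow:
  assumes "subgroup H G" "y \<in> carrier G" "y [^] (i::int) \<in> H" "y [^] (j::int) \<in> H" "coprime i j"
  shows "y \<in> H"
proof -
  obtain u v where "u * i + v * j = 1"
    using bezout_int[of i j] assms(5) by (auto simp: coprime_iff_gcd_eq_1)
  then have "y = y [^] (i * u + j * v)"
    using assms(2) by (simp add: mult.commute)
  also have "\<dots> = (y [^] i) [^] u \<otimes> (y [^] j) [^] v"
    using assms(2) by (simp add: int_pow_mult int_pow_pow)
  also have "\<dots> \<in> H"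
    using assms by (simp add: subgroup_int_pow_closed subgroup.m_closed)
  finally show ?thesis .
qed

text \<open>A subgroup of maximal size among those meeting \<open>\<langle>a\<rangle>\<close> trivially is a complement.\<close>

lemma (in comm_group) cyclic_subgroup_complement:
  assumes fin: "finite (carrier G)" and p: "prime p" and a: "a \<in> carrier G"
    and orda: "ord a = p ^ k" and exp: "\<And>x. x \<in> carrier G \<Longrightarrow> x [^] (p ^ k) = \<one>"
  obtains K where "subgroup K G" "generate G {a} \<inter> K = {\<one>}" "generate G {a} <#> K = carrier G"
proof -
  define C where "C = generate G {a}"
  have C_eq: "C = {a [^] (i::int) | i. True}"
    using generate_pow[OF a] by (simp add: C_def)
  have subC: "subgroup C G"
    unfolding C_def using a by (intro generate_is_subgroup) auto
  define P where "P = (\<lambda>K. subgroup K G \<and> C \<inter> K = {\<one>})"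
  have P1: "P {\<one>}"
    using subgroup.one_closed[OF subC] by (simp add: P_def triv_subgroup)
  have bound: "\<forall>K. P K \<longrightarrow> card K < Suc (card (carrier G))"
    by (auto simp: P_def intro!: le_imp_less_Suc card_mono[OF fin] dest: subgroup.subset)
  obtain K where K: "P K" and maxK: "\<And>K'. P K' \<Longrightarrow> card K' \<le> card K"
    using ex_has_greatest_nat[OF P1 bound] by auto
  have subK: "subgroup K G" and CK: "C \<inter> K = {\<one>}"
    using K by (auto simp: P_def)
  define M where "M = C <#> K"
  have subM: "subgroup M G"
    unfolding M_def by (rule mult_subgroups[OF subC subK])
  have CM: "C \<subseteq> M" and KM: "K \<subseteq> M"
    unfolding M_def using subset_set_mult[OF subC subK] by auto
  have "M = carrier G"
  proof (rule ccontr)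
    assume "M \<noteq> carrier G"
    then obtain x0 where x0: "x0 \<in> carrier G" "x0 \<notin> M"
      using subgroup.subset[OF subM] by blast
    \<comment> \<open>The last power of \<open>x0\<close> before the sequence of \<open>p\<close>-th
      powers enters \<open>M\<close> is an element outside \<open>M\<close> whose
      \<open>p\<close>-th power lies in \<open>M\<close>.\<close>
    define l where "l = (LEAST j. x0 [^] (p ^ j) \<in> M)"
    have l: "x0 [^] (p ^ l) \<in> M"
      unfolding l_def by (rule LeastI[of _ k]) (use exp[OF x0(1)] subgroup.one_closed[OF subM] in simp)
    have "l \<noteq> 0"
      using l x0 by (metis nat_pow_eone power_0)
    then obtain l' where l': "l = Suc l'"
      by (cases l) auto
    define x where "x = x0 [^] (p ^ l')"
    have x: "x \<in> carrier G" "x \<notin> M" "x [^] p \<in> M"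
      using x0 l not_less_Least[of l' "\<lambda>j. x0 [^] (p ^ j) \<in> M"]
      by (auto simp: x_def l' l_def[symmetric] nat_pow_pow mult.commute)
    have k: "k \<noteq> 0"
      using exp[OF x(1)] x(1,2) subgroup.one_closed[OF subM] by (metis nat_pow_eone power_0)
    obtain s c where c: "c \<in> K" and xp: "x [^] p = a [^] (s::int) \<otimes> c"
      using x(3) by (auto simp: M_def set_mult_def C_eq)
    have cG: "c \<in> carrier G"
      using c subgroup.mem_carrier[OF subK] by blast
    \<comment> \<open>Raising the equation for \<open>x [^] p\<close> to the power
      \<open>p ^ (k - 1)\<close> kills its left side by \<open>exp\<close>. The power of
      \<open>a\<close> that remains lies in \<open>C \<inter> K\<close>, so it is trivial; as
      \<open>a\<close> has order \<open>p ^ k\<close>, this forces \<open>p\<close> to divide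
      \<open>s\<close>.\<close>
    have "\<one> = (x [^] p) [^] (p ^ (k - 1))"
      using exp[OF x(1)] x(1) k by (simp add: nat_pow_pow flip: power_Suc)
    also have "\<dots> = (a [^] s) [^] (p ^ (k - 1)) \<otimes> c [^] (p ^ (k - 1))"
      using a cG by (simp add: xp pow_mult_distrib m_comm)
    finally have 1: "\<one> = (a [^] s) [^] (p ^ (k - 1)) \<otimes> c [^] (p ^ (k - 1))" .
    then have "(a [^] s) [^] (p ^ (k - 1)) = inv (c [^] (p ^ (k - 1)))"
      using a cG by (metis inv_equality int_pow_closed nat_pow_closed)
    then have "(a [^] s) [^] (p ^ (k - 1)) \<in> K"
      using subgroup_int_pow_closed[OF subK c, of "int (p ^ (k - 1))"]
      by (simp only: int_pow_int subgroup.m_inv_closed[OF subK])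
    moreover have "(a [^] s) [^] (p ^ (k - 1)) = a [^] (s * int (p ^ (k - 1)))"
      using a by (simp only: int_pow_int[symmetric] int_pow_pow)
    moreover have "a [^] (s * int (p ^ (k - 1))) \<in> C"
      unfolding C_eq by auto
    ultimately have "a [^] (s * int (p ^ (k - 1))) = \<one>"
      using CK by (simp add: set_eq_iff) metis
    then have "int (p ^ k) dvd s * int (p ^ (k - 1))"
      using a orda by (simp only: int_pow_eq_id)
    moreover have "p ^ k = p * p ^ (k - 1)"
      using k by (simp flip: power_Suc)
    ultimately have "int p dvd s"
      using p by (simp add: prime_gt_0_nat)
    then obtain u where u: "s = int p * u" ..
    \<comment> \<open>Since \<open>s = p * u\<close>, dividing \<open>x\<close> by
      \<open>a [^] u\<close> moves its \<open>p\<close>-th power into \<open>K\<close> without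
      moving \<open>x\<close> into \<open>M\<close>.\<close>
    define y where "y = x \<otimes> inv (a [^] u)"
    have y: "y \<in> carrier G"
      using x a by (simp add: y_def)
    have xy: "x = a [^] u \<otimes> y"
      using x a by (simp add: y_def m_comm[of _ "inv _"] m_assoc[symmetric] m_lcomm)
    have "(a [^] u) [^] p = a [^] s"
      using a by (simp add: u int_pow_int[symmetric] int_pow_pow mult.commute)
    then have "x [^] p = a [^] s \<otimes> y [^] p"
      using a y by (simp add: xy pow_mult_distrib[OF m_comm])
    then have "y [^] p = c"
      using xp a y cG by simp
    then have yp: "y [^] p \<in> K" using c by simp
    have yM: "y \<notin> M"
      using xy x(2) subgroup.m_closed[OF subM] CM C_eq by blast
    define K' where "K' = K <#> generate G {y}"
    have suby: "subgroup (generate G {y}) G"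
      using y by (intro generate_is_subgroup) auto
    have subK': "subgroup K' G"
      unfolding K'_def by (rule mult_subgroups[OF subK suby])
    have "y \<in> K'"
      unfolding K'_def using subset_set_mult(2)[OF subK suby] generate.incl[of y "{y}"] by auto
    then have "K \<subset> K'"
      using subset_set_mult(1)[OF subK suby] yM KM by (auto simp: K'_def)
    then have "card K < card K'"
      using subgroup.subset[OF subK'] fin by (metis finite_subset psubset_card_mono)
    \<comment> \<open>If \<open>z = b \<otimes> y [^] i\<close> lies in \<open>C\<close>, then
      \<open>y [^] i\<close> lies in \<open>M\<close>, so \<open>p\<close> divides \<open>i\<close>
      and \<open>y [^] i\<close> lies in \<open>K\<close>. Hence \<open>z\<close> lies in
      \<open>C \<inter> K\<close>, and the larger subgroup \<open>K'\<close> contradicts the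
      maximality of \<open>K\<close>.\<close>
    moreover have "C \<inter> K' \<subseteq> {\<one>}"
    proof
      fix z assume z: "z \<in> C \<inter> K'"
      then obtain b i where b: "b \<in> K" and zb: "z = b \<otimes> y [^] (i::int)"
        unfolding K'_def set_mult_def using generate_pow[OF y] by auto
      have bG: "b \<in> carrier G" using b subgroup.mem_carrier[OF subK] by blast
      have "y [^] i = inv b \<otimes> z"
        using bG y by (simp add: zb m_assoc[symmetric])
      then have yi: "y [^] i \<in> M"
        using z b CM KM subM by (auto intro!: subgroup.m_closed subgroup.m_inv_closed)
      have "y [^] int p \<in> K"
        using yp by (simp add: int_pow_int)
      have "\<not> coprime i (int p)"
        using subgroup_coprime_int_pow[OF subM y yi, of "int p"] yM \<open>y [^] int p \<in> K\<close> KM by blast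
      then have "int p dvd i"
        using p by (metis coprime_commute prime_imp_coprime prime_nat_int_transfer)
      then obtain w where "i = int p * w" ..
      then have "y [^] i = (y [^] int p) [^] w"
        using y by (simp add: int_pow_pow)
      then have "y [^] i \<in> K"
        using \<open>y [^] int p \<in> K\<close> subK by (simp add: subgroup_int_pow_closed)
      then have "z \<in> K"
        using zb b subK by (simp add: subgroup.m_closed)
      then show "z \<in> {\<one>}" using z CK by blast
    qed
    then have "P K'"
      unfolding P_def using subK' subgroup.one_closed[OF subC] subgroup.one_closed[OF subK'] by blast
    ultimately show False using maxK by fastforce
  qed
  then show thesis
    using that subK CK unfolding M_def C_def by blast
qed

lemma (in group) integer_mod_group_iso_generate:
  assumes a: "a \<in> carrier G" and n: "ord a = n" "0 < n"
  shows "integer_mod_group n \<cong> subgroup_generated G {a}"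
proof (rule is_isoI[OF isoI])
  let ?h = "\<lambda>i::int. a [^] i"
  have eq: "a [^] i = a [^] j \<longleftrightarrow> int n dvd i - j" for i j :: int
    using a n by (simp add: int_pow_eq dvd_diff_commute)
  have md: "a [^] (i mod int n) = a [^] i" for i :: int
    by (simp add: eq dvd_eq_mod_eq_0)
      (metis dvd_eq_mod_eq_0 dvd_minus_mod minus_diff_eq dvd_minus_iff)
  have car: "carrier (subgroup_generated G {a}) = range ?h"
    using a generate_pow[OF a] by (auto simp: carrier_subgroup_generated)
  show "?h \<in> hom (integer_mod_group n) (subgroup_generated G {a})"
    using a by (auto simp: hom_def car md int_pow_mult)
  have "inj_on ?h {0..<int n}"
    by (auto simp: inj_on_def eq) (smt (verit) zdvd_imp_le zdvd_not_zless dvd_diff_commute)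
  moreover have "?h ` {0..<int n} = range ?h"
    using md n by (force simp: image_iff intro!: bexI[of _ "_ mod int n"])
  ultimately show "bij_betw ?h (carrier (integer_mod_group n)) (carrier (subgroup_generated G {a}))"
    using n by (simp add: bij_betw_def car carrier_integer_mod_group)
qed

section \<open>Torsion counts and exponent lists\<close>

abbreviation cyclic_product :: "nat \<Rightarrow> nat list \<Rightarrow> (nat \<Rightarrow> int) monoid" where
  "cyclic_product p ns \<equiv> product_group {..<length ns} (\<lambda>i. integer_mod_group (p ^ (ns ! i)))"

text \<open>If \<open>n \<le> j\<close>, everything is killed; otherwise the solutions are the
  multiples of \<open>p ^ (n - j)\<close>, of which there are \<open>p ^ j\<close>.\<close>

lemma card_torsion_integer_mod_group:
  assumes "0 < (p::nat)"
  shows "card {x \<in> {0..<int (p ^ n)}. int (p ^ j) * x mod int (p ^ n) = 0} = p ^ min j n"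
proof (cases "n \<le> j")
  case True
  then have "int (p ^ n) dvd int (p ^ j) * x" for x
    by (simp add: le_imp_power_dvd)
  then have "{x \<in> {0..<int (p ^ n)}. int (p ^ j) * x mod int (p ^ n) = 0} = {0..<int (p ^ n)}"
    by auto
  then show ?thesis using True by (simp add: min_def nat_power_eq)
next
  case False
  then obtain d where n: "n = j + d"
    using le_Suc_ex nat_le_linear by blast
  have "{x \<in> {0..<int (p ^ n)}. int (p ^ j) * x mod int (p ^ n) = 0} = (\<lambda>y. int (p ^ d) * y) ` {0..<int (p ^ j)}"
    (is "?L = ?R")
  proof (intro Set.set_eqI iffI)
    fix x assume "x \<in> ?L"
    then have x: "0 \<le> x" "x < int (p ^ n)" and "int (p ^ j) * int (p ^ d) dvd int (p ^ j) * x"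
      by (auto simp: n power_add)
    then have "int (p ^ d) dvd x"
      using assms by (simp only: dvd_mult_cancel_left) simp
    then obtain y where y: "x = int (p ^ d) * y" ..
    have pos: "0 < int (p ^ d)" using assms by simp
    have "int (p ^ d) * 0 \<le> int (p ^ d) * y" "int (p ^ d) * y < int (p ^ d) * int (p ^ j)"
      using x by (auto simp: y n power_add mult.commute)
    then have "0 \<le> y" "y < int (p ^ j)"
      using pos by (simp_all only: mult_le_cancel_left_pos mult_less_cancel_left_pos)
    then show "x \<in> ?R" using y by auto
  next
    fix x assume "x \<in> ?R"
    then show "x \<in> ?L"
      using assms by (auto simp: n power_add mult.commute mult.left_commute)
  qed
  moreover have "inj_on (\<lambda>y. int (p ^ d) * y) {0..<int (p ^ j)}"
    using assms by (auto simp: inj_on_def)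
  ultimately show ?thesis
    by (simp add: card_image nat_power_eq n min_def)
qed

text \<open>Torsion in a product is decided coordinate by coordinate, so the counts of the factors
  multiply and their exponents add up.\<close>

lemma card_torsion_cyclic_product:
  assumes "0 < (p::nat)"
  shows "card {x \<in> carrier (cyclic_product p ns). x [^]\<^bsub>cyclic_product p ns\<^esub> (p ^ j) = \<one>\<^bsub>cyclic_product p ns\<^esub>}
    = p ^ (\<Sum>i<length ns. min j (ns ! i))"
proof -
  have "{x \<in> carrier (cyclic_product p ns). x [^]\<^bsub>cyclic_product p ns\<^esub> (p ^ j) = \<one>\<^bsub>cyclic_product p ns\<^esub>}
    = (\<Pi>\<^sub>E i\<in>{..<length ns}. {x \<in> {0..<int (p ^ (ns ! i))}. int (p ^ j) * x mod int (p ^ (ns ! i)) = 0})"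
  proof (intro Set.set_eqI iffI)
    fix x assume "x \<in> {x \<in> carrier (cyclic_product p ns). x [^]\<^bsub>cyclic_product p ns\<^esub> (p ^ j) = \<one>\<^bsub>cyclic_product p ns\<^esub>}"
    then have "x \<in> carrier (cyclic_product p ns)"
      "(\<lambda>i\<in>{..<length ns}. int (p ^ j) * x i mod int (p ^ (ns ! i))) = (\<lambda>i\<in>{..<length ns}. 0)"
      by (auto simp del: carrier_product_group simp: pow_product_group)
    then show "x \<in> (\<Pi>\<^sub>E i\<in>{..<length ns}. {x \<in> {0..<int (p ^ (ns ! i))}. int (p ^ j) * x mod int (p ^ (ns ! i)) = 0})"
      using assms by (auto simp: PiE_iff carrier_integer_mod_group dest: fun_cong split: if_splits)
  next
    fix x assume x: "x \<in> (\<Pi>\<^sub>E i\<in>{..<length ns}. {x \<in> {0..<int (p ^ (ns ! i))}. int (p ^ j) * x mod int (p ^ (ns ! i)) = 0})"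
    then have "x \<in> carrier (cyclic_product p ns)"
      by (auto simp: PiE_iff carrier_integer_mod_group)
    moreover have "(\<lambda>i\<in>{..<length ns}. int (p ^ j) * x i mod int (p ^ (ns ! i))) = (\<lambda>i\<in>{..<length ns}. 0)"
      using x by (intro restrict_ext) (auto simp: PiE_iff)
    ultimately show "x \<in> {x \<in> carrier (cyclic_product p ns). x [^]\<^bsub>cyclic_product p ns\<^esub> (p ^ j) = \<one>\<^bsub>cyclic_product p ns\<^esub>}"
      by (simp del: carrier_product_group add: pow_product_group)
  qed
  then show ?thesis
    by (simp only: card_PiE finite_lessThan card_torsion_integer_mod_group[OF assms] power_sum)
qed

lemma iso_card_torsion:
  assumes "group A" "group B" "A \<cong> B"
  shows "card {x \<in> carrier A. x [^]\<^bsub>A\<^esub> (m::nat) = \<one>\<^bsub>A\<^esub>} = card {x \<in> carrier B. x [^]\<^bsub>B\<^esub> m = \<one>\<^bsub>B\<^esub>}"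
proof -
  obtain h where h: "h \<in> hom A B" and bij: "bij_betw h (carrier A) (carrier B)"
    using assms(3) by (auto simp: is_iso_def iso_def)
  interpret group_hom A B h
    using assms h by (simp add: group_hom_def group_hom_axioms_def)
  have "h x [^]\<^bsub>B\<^esub> m = \<one>\<^bsub>B\<^esub> \<longleftrightarrow> x [^]\<^bsub>A\<^esub> m = \<one>\<^bsub>A\<^esub>" if "x \<in> carrier A" for x
    using inj_on_eq_iff[OF bij_betw_imp_inj_on[OF bij], of "x [^]\<^bsub>A\<^esub> m" "\<one>\<^bsub>A\<^esub>"] that by (simp add: hom_nat_pow)
  then have "h ` {x \<in> carrier A. x [^]\<^bsub>A\<^esub> m = \<one>\<^bsub>A\<^esub>} = {x \<in> carrier B. x [^]\<^bsub>B\<^esub> m = \<one>\<^bsub>B\<^esub>}"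
    using bij_betw_imp_surj_on[OF bij, symmetric] by auto
  then have "bij_betw h {x \<in> carrier A. x [^]\<^bsub>A\<^esub> m = \<one>\<^bsub>A\<^esub>} {x \<in> carrier B. x [^]\<^bsub>B\<^esub> m = \<one>\<^bsub>B\<^esub>}"
    using bij_betw_subset[OF bij, of "{x \<in> carrier A. x [^]\<^bsub>A\<^esub> m = \<one>\<^bsub>A\<^esub>}"] by auto
  then show ?thesis by (rule bij_betw_same_card)
qed

lemma group_cyclic_product: "group (cyclic_product p ns)"
  by simp

lemma cyclic_decomposition_card_torsion:
  assumes "group A" "0 < p" "cyclic_decomposition p A ns"
  shows "card {x \<in> carrier A. x [^]\<^bsub>A\<^esub> (p ^ j) = \<one>\<^bsub>A\<^esub>} = p ^ (\<Sum>i<length ns. min j (ns ! i))"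
proof -
  have "A \<cong> cyclic_product p ns"
    using assms(3) by (simp add: cyclic_decomposition_def)
  then show ?thesis
    using iso_card_torsion[OF assms(1) group_cyclic_product] card_torsion_cyclic_product[OF assms(2)] by simp
qed

lemma cyclic_decomposition_card:
  assumes "0 < p" "cyclic_decomposition p A ns"
  shows "card (carrier A) = p ^ (\<Sum>i<length ns. ns ! i)"
proof -
  have "card (carrier A) = card (carrier (cyclic_product p ns))"
    using assms(2) iso_same_card unfolding cyclic_decomposition_def by metis
  also have "\<dots> = p ^ (\<Sum>i<length ns. ns ! i)"
    using assms(1) by (simp add: card_PiE carrier_integer_mod_group power_sum nat_power_eq)
  finally show ?thesis .
qed

text \<open>Counting the elements killed by \<open>p ^ j\<close> recovers everything needed about the
  exponent lists, without proving their uniqueness.\<close>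

lemma last_exponent_difference:
  fixes ns ms :: "nat list"
  assumes sorted: "sorted_wrt (\<ge>) ns" and len: "length ms = length ns" and neq: "ns \<noteq> ms"
    and le: "\<And>j. (\<Sum>i<length ns. min j (ns ! i)) \<le> (\<Sum>i<length ns. min j (ms ! i))"
  obtains r where "r < length ns" "ns ! r < ms ! r" "\<And>j. r < j \<Longrightarrow> j < length ns \<Longrightarrow> ns ! j = ms ! j"
proof -
  define D where "D = {i. i < length ns \<and> ns ! i \<noteq> ms ! i}"
  have "finite D" "D \<noteq> {}"
    using len neq by (auto simp: D_def list_eq_iff_nth_eq)
  define r where "r = Max D"
  have r: "r < length ns" "ns ! r \<noteq> ms ! r"
    using Max_in[OF \<open>finite D\<close> \<open>D \<noteq> {}\<close>] by (auto simp: r_def D_def)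
  have tail: "ns ! j = ms ! j" if "r < j" "j < length ns" for j
  proof (rule ccontr)
    assume "ns ! j \<noteq> ms ! j"
    then have "j \<in> D" using that by (simp add: D_def)
    then show False using Max_ge[OF \<open>finite D\<close>] that(1) by (auto simp: r_def not_le[symmetric])
  qed
  have "\<not> ms ! r < ns ! r"
  proof
    assume lt: "ms ! r < ns ! r"
    \<comment> \<open>As \<open>ns\<close> is decreasing, truncation at \<open>ns ! r\<close> leaves
      every term of \<open>ns\<close> up to \<open>r\<close> at the full value
      \<open>ns ! r\<close>, whereas \<open>ms\<close> falls short at \<open>r\<close>. The tails
      agree, so the sum for \<open>ns\<close> is larger, against \<open>le\<close>.\<close>
    let ?j = "ns ! r"
    have split: "(\<Sum>i<length ns. f i) = (\<Sum>i\<le>r. f i) + (\<Sum>i\<in>{r<..<length ns}. f i)" for f :: "nat \<Rightarrow> nat"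
    proof -
      have "{..<length ns} = {..r} \<union> {r<..<length ns}" using r by auto
      then show ?thesis by (simp add: sum.union_disjoint disjoint_iff)
    qed
    have "(\<Sum>i\<in>{r<..<length ns}. min ?j (ns ! i)) = (\<Sum>i\<in>{r<..<length ns}. min ?j (ms ! i))"
      using tail by (intro sum.cong) auto
    then have "(\<Sum>i\<le>r. min ?j (ns ! i)) \<le> (\<Sum>i\<le>r. min ?j (ms ! i))"
      using le[of ?j] split[of "\<lambda>i. min ?j (ns ! i)"] split[of "\<lambda>i. min ?j (ms ! i)"] by linarith
    moreover have "ns ! i \<ge> ?j" if "i \<le> r" for i
      using that sorted r by (cases "i = r") (auto simp: sorted_wrt_iff_nth_less)
    then have "(\<Sum>i\<le>r. min ?j (ms ! i)) < (\<Sum>i\<le>r. min ?j (ns ! i))"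
      using lt by (intro sum_strict_mono_ex1 bexI[of _ r]) auto
    ultimately show False by simp
  qed
  then show thesis using that r tail by (meson linorder_neqE_nat)
qed

text \<open>If \<open>k\<close> exceeded \<open>ns ! r\<close>, the sums truncated at
  \<open>Suc (ns ! r)\<close> would agree. But \<open>ms\<close> is decreasing, so its terms up to
  \<open>r\<close> all reach the truncation bound, while \<open>ns\<close> stays below it at
  \<open>r\<close>. The number \<open>ns ! r\<close> bounded here is the exponent that occurs in
  \<open>var\<close>.\<close>

lemma exponents_truncation:
  fixes ns ms :: "nat list"
  assumes sorted: "sorted_wrt (\<ge>) ms" and len: "length ms = length ns"
    and eq: "\<And>j. j \<le> k \<Longrightarrow> (\<Sum>i<length ns. min j (ns ! i)) = (\<Sum>i<length ns. min j (ms ! i))"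
    and r: "r < length ns" "ns ! r < ms ! r" "\<And>j. r < j \<Longrightarrow> j < length ns \<Longrightarrow> ns ! j = ms ! j"
  shows "k \<le> ns ! r"
proof (rule ccontr)
  let ?j = "Suc (ns ! r)"
  assume "\<not> k \<le> ns ! r"
  then have "(\<Sum>i<length ns. min ?j (ns ! i)) = (\<Sum>i<length ns. min ?j (ms ! i))"
    by (intro eq) simp
  moreover have "ms ! i \<ge> ?j" if "i \<le> r" for i
    using that sorted r len by (cases "i = r") (auto simp: sorted_wrt_iff_nth_less Suc_le_eq intro: less_le_trans)
  then have "min ?j (ns ! i) \<le> min ?j (ms ! i)" if "i < length ns" for i
    using r(3) that by (cases "i \<le> r") auto
  then have "(\<Sum>i<length ns. min ?j (ns ! i)) < (\<Sum>i<length ns. min ?j (ms ! i))"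
    using r by (intro sum_strict_mono_ex1 bexI[of _ r]) auto
  ultimately show False by simp
qed

text \<open>An entry above \<open>k\<close> would make the number of elements killed by
  \<open>p ^ k\<close> smaller than the order of \<open>A\<close>. This keeps the list sorted when
  the exponent of a factor of maximal order is put in front.\<close>

lemma cyclic_decomposition_le:
  assumes "group A" and p: "prime p" and dec: "cyclic_decomposition p A ns"
    and exp: "\<And>x. x \<in> carrier A \<Longrightarrow> x [^]\<^bsub>A\<^esub> (p ^ k) = \<one>\<^bsub>A\<^esub>" and i: "i < length ns"
  shows "ns ! i \<le> k"
proof (rule ccontr)
  assume "\<not> ns ! i \<le> k"
  then have "(\<Sum>i<length ns. min k (ns ! i)) < (\<Sum>i<length ns. ns ! i)"
    using i by (intro sum_strict_mono_ex1 bexI[of _ i]) auto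
  moreover have "{x \<in> carrier A. x [^]\<^bsub>A\<^esub> (p ^ k) = \<one>\<^bsub>A\<^esub>} = carrier A"
    using exp by auto
  then have "p ^ (\<Sum>i<length ns. min k (ns ! i)) = p ^ (\<Sum>i<length ns. ns ! i)"
    using cyclic_decomposition_card_torsion[OF assms(1) prime_gt_0_nat[OF p] dec, of k]
      cyclic_decomposition_card[OF prime_gt_0_nat[OF p] dec] by simp
  ultimately show False
    using prime_gt_1_nat[OF p] by (simp add: power_inject_exp)
qed

section \<open>Existence of cyclic decompositions\<close>

text \<open>Element orders are powers of \<open>p\<close>, so they are totally ordered by
  divisibility and the largest one is a multiple of all others.\<close>

lemma (in group) exists_ord_prime_power_max:
  assumes fin: "finite (carrier G)" and p: "prime p" and card: "card (carrier G) = p ^ m"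
  obtains a k where "a \<in> carrier G" "ord a = p ^ k" "\<And>x. x \<in> carrier G \<Longrightarrow> x [^] (p ^ k) = \<one>"
proof -
  have pow: "\<exists>j. ord x = p ^ j" if "x \<in> carrier G" for x
    using ord_dvd_group_order[OF that] divides_primepow_nat[OF p] by (auto simp: order_def card)
  have "Max (ord ` carrier G) \<in> ord ` carrier G"
    using fin by (intro Max_in) auto
  then obtain a where a: "a \<in> carrier G" "ord a = Max (ord ` carrier G)"
    by (metis imageE)
  then obtain k where k: "ord a = p ^ k"
    using pow by blast
  show thesis
  proof (rule that[OF a(1) k])
    fix x assume x: "x \<in> carrier G"
    then obtain j where j: "ord x = p ^ j"
      using pow by blast
    have "p ^ j \<le> p ^ k"
      using a fin x by (simp flip: j k)
    then have "ord x dvd p ^ k"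
      using prime_gt_1_nat[OF p] by (simp add: j le_imp_power_dvd power_increasing_iff)
    then show "x [^] (p ^ k) = \<one>"
      using x by (simp add: pow_eq_id)
  qed
qed

text \<open>Strong induction on \<open>m\<close>: an element of maximal order generates a direct
  factor, and its complement has smaller order. Maximality also bounds the exponents of the
  complement by \<open>k\<close>, so \<open>k # ns\<close> is again decreasing.\<close>

theorem cyclic_decomposition_exists:
  assumes p: "prime p"
  shows "\<lbrakk>comm_group A; finite (carrier A); card (carrier A) = p ^ m\<rbrakk> \<Longrightarrow> \<exists>ns. cyclic_decomposition p A ns"
proof (induction m arbitrary: A rule: less_induct)
  case (less m)
  interpret comm_group A by (rule less.prems)
  obtain a k where a: "a \<in> carrier A" and k: "ord a = p ^ k"
    and exp: "\<And>x. x \<in> carrier A \<Longrightarrow> x [^]\<^bsub>A\<^esub> (p ^ k) = \<one>\<^bsub>A\<^esub>"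
    using exists_ord_prime_power_max[OF less.prems(2) p less.prems(3)] by metis
  show ?case
  proof (cases "k = 0")
    case True
    then have "carrier A = {\<one>\<^bsub>A\<^esub>}"
      using exp by auto
    \<comment> \<open>The trivial group gets the empty list; the only element of the empty product
      is the function that is undefined everywhere.\<close>
    then have "(\<lambda>x. \<lambda>i. undefined) \<in> iso A (product_group {..<length []} (\<lambda>i. integer_mod_group (p ^ ([] ! i))))"
      by (auto simp: iso_def hom_def bij_betw_def)
    then have "cyclic_decomposition p A []"
      by (simp add: cyclic_decomposition_def is_isoI)
    then show ?thesis ..
  next
    case False
    obtain K where K: "subgroup K A" "generate A {a} \<inter> K = {\<one>\<^bsub>A\<^esub>}" "generate A {a} <#>\<^bsub>A\<^esub> K = carrier A"
      using cyclic_subgroup_complement[OF less.prems(2) p a k exp] by metis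
    have suba: "subgroup (generate A {a}) A"
      using a by (intro generate_is_subgroup) auto
    interpret group_disjoint_sum A "generate A {a}" K
      by (intro group_disjoint_sum.intro suba K(1)) unfold_locales
    let ?C = "subgroup_generated A {a}" and ?K = "subgroup_generated A K"
    \<comment> \<open>The product decomposition speaks of the subgroup
      \<open>generate A {a}\<close>, the isomorphism with a cyclic group of the generator
      \<open>a\<close>; both give the same structure.\<close>
    have "subgroup_generated A (generate A {a}) = ?C"
      using a by (simp add: subgroup_generated_def generate_is_subgroup subgroup.carrier_subgroup_generated_subgroup)
        (metis BG.subgroup_axioms Int_absorb1 carrier_subgroup_generated generate_in_carrier subgroup.carrier_subgroup_generated_subgroup suba subsetI singletonD)
    then have "?C \<times>\<times> ?K \<cong> A"
      using iso_group_mul[OF less.prems(1)] K(2,3) is_isoI[of _ "?C \<times>\<times> ?K"] by (metis order_refl)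
    have "group (?C \<times>\<times> ?K)"
      by (simp add: DirProd_group)
    have "?C \<cong> integer_mod_group (p ^ k)"
      using integer_mod_group_iso_generate[OF a k] prime_gt_0_nat[OF p]
      by (simp add: group.iso_sym[OF group_integer_mod_group])
    have "comm_group ?K"
      by (metis abelian_subgroup_generated less.prems(1))
    have "carrier ?K = K"
      using K(1) by (simp add: subgroup.carrier_subgroup_generated_subgroup)
    have "card (carrier A) = card (carrier ?C) * card (carrier ?K)"
      using iso_same_card[OF \<open>?C \<times>\<times> ?K \<cong> A\<close>] by (simp add: card_cartesian_product)
    moreover have "card (carrier ?C) = p ^ k"
      using iso_same_card[OF \<open>?C \<cong> _\<close>] prime_gt_0_nat[OF p]
      by (simp add: carrier_integer_mod_group nat_power_eq)
    ultimately have cardK: "p ^ m = p ^ k * card (carrier ?K)"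
      by (simp add: less.prems(3))
    then obtain m' where m': "card (carrier ?K) = p ^ m'"
      using divides_primepow_nat[OF p, of "card (carrier ?K)" m] by auto
    with cardK have "p ^ m = p ^ (k + m')"
      by (simp add: power_add)
    then have "m' < m"
      using False prime_gt_1_nat[OF p] by (simp add: power_inject_exp)
    moreover have "finite (carrier ?K)"
      using less.prems(2) K(1) by (metis \<open>carrier ?K = K\<close> finite_subset subgroup.subset)
    ultimately obtain ns where ns: "cyclic_decomposition p ?K ns"
      using less.IH[OF _ \<open>comm_group ?K\<close> _ m'] by blast
    have le: "ns ! i \<le> k" if "i < length ns" for i
    proof (rule cyclic_decomposition_le[OF _ p ns _ that])
      fix x assume "x \<in> carrier ?K"
      then show "x [^]\<^bsub>?K\<^esub> (p ^ k) = \<one>\<^bsub>?K\<^esub>"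
        using exp K(1) by (simp add: \<open>carrier ?K = K\<close> pow_subgroup_generated subgroup.mem_carrier)
    qed simp
    have "A \<cong> ?C \<times>\<times> ?K"
      using \<open>?C \<times>\<times> ?K \<cong> A\<close> \<open>group (?C \<times>\<times> ?K)\<close> by (simp add: group.iso_sym)
    also have "\<dots> \<cong> integer_mod_group (p ^ k) \<times>\<times> cyclic_product p ns"
      using ns \<open>?C \<cong> _\<close> by (intro group.DirProd_iso_trans) (auto simp: cyclic_decomposition_def)
    also have "\<dots> \<cong> cyclic_product p (k # ns)"
      using product_group_Suc[of "\<lambda>i. integer_mod_group (p ^ ((k # ns) ! i))" "length ns"] by simp
    finally have "cyclic_decomposition p A (k # ns)"
      using ns le False by (auto simp: cyclic_decomposition_def in_set_conv_nth)
    then show ?thesis ..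
  qed
qed

lemma cyclic_decomposition_exponents:
  assumes "prime p" "comm_group A" "finite (carrier A)" "card (carrier A) = p ^ m"
  shows "cyclic_decomposition p A (cyclic_exponents p A)"
  unfolding cyclic_exponents_def using cyclic_decomposition_exists[OF assms] by (rule someI_ex)

section \<open>The rank is the number of cyclic factors\<close>

definition unit_vector :: "nat \<Rightarrow> nat \<Rightarrow> nat \<Rightarrow> int" where
  "unit_vector t m = (\<lambda>i\<in>{..<t}. if i = m then 1 else 0)"

lemma unit_vector_carrier:
  assumes "prime p" "\<forall>k\<in>set ns. 0 < k"
  shows "unit_vector (length ns) m \<in> carrier (cyclic_product p ns)"
  using assms prime_gt_1_nat[OF assms(1)]
  by (auto simp: unit_vector_def carrier_integer_mod_group PiE_iff nth_mem)

lemma generate_unit_vectors: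
  assumes p: "prime p" and pos: "\<forall>k\<in>set ns. 0 < k"
  shows "generate (cyclic_product p ns) (unit_vector (length ns) ` {..<length ns}) = carrier (cyclic_product p ns)"
    (is "generate ?P ?E = _")
proof
  let ?t = "length ns"
  interpret P: group ?P by simp
  have E: "?E \<subseteq> carrier ?P"
    using unit_vector_carrier[OF p pos] by blast
  show "generate ?P ?E \<subseteq> carrier ?P"
    using E by (rule P.generate_incl)
  \<comment> \<open>Induction on the number \<open>m\<close> of leading coordinates that may be
    nonzero; coordinate \<open>m\<close> is cleared by splitting off a power of its unit
    vector.\<close>
  have "x \<in> generate ?P ?E" if "x \<in> carrier ?P" "\<And>i. m \<le> i \<Longrightarrow> i < ?t \<Longrightarrow> x i = 0" "m \<le> ?t" for x m
    using that
  proof (induction m arbitrary: x)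
    case 0
    then have "x = \<one>\<^bsub>?P\<^esub>"
      by (auto simp: PiE_iff extensional_def restrict_def)
    then show ?case by (simp only: generate.one)
  next
    case (Suc m)
    let ?x = "x(m := 0)"
    have m: "m < ?t" and xm: "0 \<le> x m" and xi: "\<And>i. i < ?t \<Longrightarrow> x i mod int (p ^ (ns ! i)) = x i"
      using Suc.prems prime_gt_0_nat[OF p] by (auto simp: PiE_iff carrier_integer_mod_group)
    have "?x \<in> carrier ?P"
      using Suc.prems(1) m by (auto simp: PiE_iff extensional_def)
    moreover have "?x i = 0" if "m \<le> i" "i < ?t" for i
      using Suc.prems(2)[of i] that by (cases "i = m") auto
    ultimately have "?x \<in> generate ?P ?E"
      using m by (intro Suc.IH) auto
    moreover have "unit_vector ?t m [^]\<^bsub>?P\<^esub> nat (x m) \<in> generate ?P ?E"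
      using m P.subgroup_int_pow_closed[OF P.generate_is_subgroup[OF E], of "unit_vector ?t m" "int (nat (x m))"]
      by (simp only: int_pow_int) (simp add: generate.incl)
    moreover have "unit_vector ?t m [^]\<^bsub>?P\<^esub> nat (x m)
        = (\<lambda>i\<in>{..<?t}. (if i = m then x m else 0) mod int (p ^ (ns ! i)))"
      unfolding pow_product_group[OF unit_vector_carrier[OF p pos]]
      using xm by (intro restrict_ext) (auto simp: unit_vector_def)
    then have eq: "x = ?x \<otimes>\<^bsub>?P\<^esub> unit_vector ?t m [^]\<^bsub>?P\<^esub> nat (x m)"
      using Suc.prems(1) xi m by (auto simp: fun_eq_iff PiE_iff extensional_def)
    ultimately show ?case by (subst eq) (rule generate.eng)
  qed
  then show "carrier ?P \<subseteq> generate ?P ?E" by force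
qed

lemma hom_eq_on_generate:
  assumes "group G" "group H" "f \<in> hom G H" "g \<in> hom G H" "S \<subseteq> carrier G"
    and "\<And>s. s \<in> S \<Longrightarrow> f s = g s" and "x \<in> generate G S"
  shows "f x = g x"
proof -
  interpret f: group_hom G H f using assms by (simp add: group_hom_def group_hom_axioms_def)
  interpret g: group_hom G H g using assms by (simp add: group_hom_def group_hom_axioms_def)
  show ?thesis
    using assms(7)
  proof (induction rule: generate.induct)
    case (inv h)
    then show ?case using assms(5,6) by (metis f.hom_inv g.hom_inv subsetD)
  next
    case (eng h1 h2)
    then show ?case using f.G.generate_in_carrier[OF assms(5)] by simp
  qed (use assms in auto)
qed

text \<open>All exponents are positive, so reducing a coordinate modulo \<open>p ^ (ns ! i)\<close>
  does not change it modulo \<open>p\<close>.\<close>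

lemma dot_product_hom:
  assumes pos: "\<forall>k\<in>set ns. 0 < k" and p: "0 < p"
  shows "(\<lambda>x. (\<Sum>i<length ns. c i * x i) mod int p) \<in> hom (cyclic_product p ns) (integer_mod_group p)"
proof -
  have "(\<Sum>i<length ns. c i * ((x i + y i) mod int (p ^ (ns ! i)))) mod int p
      = ((\<Sum>i<length ns. c i * x i) mod int p + (\<Sum>i<length ns. c i * y i) mod int p) mod int p" for x y
  proof -
    have "int p dvd c i * ((x i + y i) mod int (p ^ (ns ! i))) - c i * (x i + y i)" if "i < length ns" for i
    proof -
      have "int p dvd int (p ^ (ns ! i))"
        using pos that by (simp add: dvd_power)
      moreover have "int (p ^ (ns ! i)) dvd (x i + y i) mod int (p ^ (ns ! i)) - (x i + y i)"
        by (metis mod_eq_dvd_iff mod_mod_trivial)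
      ultimately show ?thesis
        by (metis dvd_mult dvd_trans right_diff_distrib)
    qed
    then have "int p dvd (\<Sum>i<length ns. c i * ((x i + y i) mod int (p ^ (ns ! i))) - c i * (x i + y i))"
      by (intro dvd_sum) auto
    then have "(\<Sum>i<length ns. c i * ((x i + y i) mod int (p ^ (ns ! i)))) mod int p
        = (\<Sum>i<length ns. c i * (x i + y i)) mod int p"
      by (simp add: mod_eq_dvd_iff sum_subtractf)
    also have "\<dots> = ((\<Sum>i<length ns. c i * x i) + (\<Sum>i<length ns. c i * y i)) mod int p"
      by (simp add: distrib_left sum.distrib)
    finally show ?thesis by (simp add: mod_add_eq)
  qed
  then show ?thesis
    using p by (simp add: hom_def carrier_integer_mod_group)
qed

text \<open>For the lower bound, the \<open>p ^ length ns\<close> homomorphisms into \<open>\<int>/p\<close> given by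
  dot products are determined by their values on a generating set.\<close>

lemma cyclic_decomposition_rank:
  assumes A: "group A" and p: "prime p" and dec: "cyclic_decomposition p A ns"
  shows "rank A = length ns"
  unfolding rank_def
proof (rule Least_equality)
  let ?t = "length ns" and ?P = "cyclic_product p ns"
  interpret A: group A by (rule A)
  interpret P: group ?P by simp
  have pos: "\<forall>k\<in>set ns. 0 < k" and iso: "A \<cong> ?P"
    using dec by (auto simp: cyclic_decomposition_def)
  then obtain h where h: "h \<in> hom A ?P" "bij_betw h (carrier A) (carrier ?P)"
    by (auto simp: is_iso_def iso_def)
  obtain g where g: "g \<in> hom ?P A" "bij_betw g (carrier ?P) (carrier A)"
    using A.iso_sym[OF iso] by (auto simp: is_iso_def iso_def)
  interpret g: group_hom ?P A g
    using g(1) by (simp add: group_hom_def group_hom_axioms_def)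
  let ?E = "unit_vector ?t ` {..<?t}"
  have E: "?E \<subseteq> carrier ?P"
    using unit_vector_carrier[OF p pos] by blast
  show "\<exists>S\<subseteq>carrier A. finite S \<and> card S = ?t \<and> generate A S = carrier A"
  proof (intro exI conjI)
    show "g ` ?E \<subseteq> carrier A"
      using E bij_betw_imp_surj_on[OF g(2)] by blast
    show "finite (g ` ?E)" by simp
    have "inj_on (unit_vector ?t) {..<?t}"
      by (auto simp: inj_on_def unit_vector_def fun_eq_iff split: if_splits)
    moreover have "inj_on g ?E"
      using g(2) E by (meson bij_betw_imp_inj_on inj_on_subset)
    ultimately show "card (g ` ?E) = ?t"
      by (simp add: card_image)
    show "generate A (g ` ?E) = carrier A"
      using g.generate_img[OF E] bij_betw_imp_surj_on[OF g(2)]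
      by (simp only: generate_unit_vectors[OF p pos])
  qed
  fix d assume "\<exists>S\<subseteq>carrier A. finite S \<and> card S = d \<and> generate A S = carrier A"
  then obtain S where S: "S \<subseteq> carrier A" "finite S" "card S = d" "generate A S = carrier A"
    by auto
  let ?C = "{..<?t} \<rightarrow>\<^sub>E {0..<int p}" and ?D = "S \<rightarrow>\<^sub>E {0..<int p}"
  define \<phi> where "\<phi> = (\<lambda>c x. (\<Sum>i<?t. c i * h x i) mod int p)"
  have \<phi>: "\<phi> c \<in> hom A (integer_mod_group p)" for c
    using hom_compose[OF h(1) dot_product_hom[OF pos prime_gt_0_nat[OF p], of c]]
    by (simp add: \<phi>_def comp_def)
  have "inj_on (\<lambda>c. restrict (\<phi> c) S) ?C"
  proof (rule inj_onI)
    fix c c' assume c: "c \<in> ?C" "c' \<in> ?C" and eq: "restrict (\<phi> c) S = restrict (\<phi> c') S"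
    have "\<phi> c s = \<phi> c' s" if "s \<in> S" for s
      using fun_cong[OF eq, of s] that by simp
    then have all: "\<phi> c x = \<phi> c' x" if "x \<in> carrier A" for x
      using hom_eq_on_generate[OF A group_integer_mod_group \<phi> \<phi> S(1), of c c' x] that S(4) by blast
    show "c = c'"
    proof (rule PiE_ext[OF c])
      fix i assume i: "i \<in> {..<?t}"
      obtain x where x: "x \<in> carrier A" "h x = unit_vector ?t i"
        using bij_betw_imp_surj_on[OF h(2)] unit_vector_carrier[OF p pos, of i] by (metis imageE)
      \<comment> \<open>Evaluation at the preimage of the \<open>i\<close>-th unit vector reads off
        the \<open>i\<close>-th coefficient, so equal homomorphisms have equal coefficients.\<close>
      have "\<phi> b x = b i" if "b \<in> ?C" for b
      proof -
        have "(\<Sum>j<?t. b j * h x j) = (\<Sum>j<?t. if j = i then b j else 0)"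
          by (intro sum.cong) (auto simp: x unit_vector_def)
        also have "\<dots> = b i" using i by simp
        finally show ?thesis using that i by (auto simp: \<phi>_def PiE_iff)
      qed
      then show "c i = c' i" using all[OF x(1)] c by simp
    qed
  qed
  moreover have "(\<lambda>c. restrict (\<phi> c) S) ` ?C \<subseteq> ?D"
    using prime_gt_0_nat[OF p] by (intro image_subsetI) (simp add: PiE_iff \<phi>_def)
  moreover have "finite ?D"
    using S(2) by (simp add: finite_PiE)
  ultimately have "card ?C \<le> card ?D"
    by (rule card_inj_on_le)
  then have "p ^ ?t \<le> p ^ d"
    using S by (simp add: card_PiE)
  then show "?t \<le> d"
    using prime_gt_1_nat[OF p] by (simp add: power_increasing_iff)
qed

lemma (in group) subgroup_card_prime_power:
  assumes "prime p" "finite (carrier G)" "order G = p ^ k" "subgroup H G"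
  obtains m where "card H = p ^ m"
proof -
  have "card H dvd p ^ k"
    using lagrange[OF assms(4)] assms(3) by (metis dvd_triv_right)
  then show thesis
    using that divides_primepow_nat[OF assms(1)] by blast
qed

section \<open>Exponent lists of a subgroup, ranks and \<open>var\<close>\<close>

context group
begin

context
  fixes p :: nat and A B :: "'a set" and ns ms :: "nat list"
  assumes p: "prime p" and A: "subgroup A G" and B: "subgroup B G" and AB: "A \<subseteq> B"
    and finB: "finite B"
    and decA: "cyclic_decomposition p (G\<lparr>carrier := A\<rparr>) ns"
    and decB: "cyclic_decomposition p (G\<lparr>carrier := B\<rparr>) ms"
begin

lemma subgroup_exponents_sum:
  "p ^ (\<Sum>i<length ns. min j (ns ! i)) = card {x \<in> A. x [^] (p ^ j) = \<one>}"
  "p ^ (\<Sum>i<length ms. min j (ms ! i)) = card {x \<in> B. x [^] (p ^ j) = \<one>}"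
  using cyclic_decomposition_card_torsion[OF subgroup_imp_group[OF A] prime_gt_0_nat[OF p] decA, of j]
    cyclic_decomposition_card_torsion[OF subgroup_imp_group[OF B] prime_gt_0_nat[OF p] decB, of j]
  by (simp_all flip: nat_pow_consistent)

lemma subgroup_exponents_le:
  "(\<Sum>i<length ns. min j (ns ! i)) \<le> (\<Sum>i<length ms. min j (ms ! i))"
proof -
  have "card {x \<in> A. x [^] (p ^ j) = \<one>} \<le> card {x \<in> B. x [^] (p ^ j) = \<one>}"
    using AB finB by (intro card_mono) auto
  then show ?thesis
    using prime_gt_1_nat[OF p] by (simp add: power_increasing_iff flip: subgroup_exponents_sum)
qed

text \<open>Whatever \<open>p ^ j\<close> kills is also killed by \<open>p ^ k\<close>, so
  \<open>A\<close> and \<open>B\<close> have the same torsion at every level up to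
  \<open>k\<close>.\<close>

lemma subgroup_exponents_eq:
  assumes "{x \<in> B. x [^] (p ^ k) = \<one>} \<subseteq> A" "j \<le> k"
  shows "(\<Sum>i<length ns. min j (ns ! i)) = (\<Sum>i<length ms. min j (ms ! i))"
proof -
  have "x [^] (p ^ k) = \<one>" if "x \<in> B" "x [^] (p ^ j) = \<one>" for x
  proof -
    have "x [^] (p ^ k) = (x [^] (p ^ j)) [^] (p ^ (k - j))"
      using assms(2) subgroup.mem_carrier[OF B that(1)] by (simp add: nat_pow_pow flip: power_add)
    then show ?thesis using that(2) by simp
  qed
  then have "{x \<in> A. x [^] (p ^ j) = \<one>} = {x \<in> B. x [^] (p ^ j) = \<one>}"
    using AB assms(1) by auto
  then have "p ^ (\<Sum>i<length ns. min j (ns ! i)) = p ^ (\<Sum>i<length ms. min j (ms ! i))"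
    by (simp add: subgroup_exponents_sum)
  then show ?thesis
    using prime_gt_1_nat[OF p] by (simp add: power_inject_exp)
qed

text \<open>At level \<open>j = 1\<close> every positive exponent contributes exactly 1, so the
  truncated sums count the cyclic factors.\<close>

lemma subgroup_exponents_length:
  assumes "{x \<in> B. x [^] p = \<one>} \<subseteq> A"
  shows "length ns = length ms"
proof -
  have "\<forall>k\<in>set ns. 0 < k" "\<forall>k\<in>set ms. 0 < k"
    using decA decB by (auto simp: cyclic_decomposition_def)
  then have "(\<Sum>i<length ns. min 1 (ns ! i)) = length ns" "(\<Sum>i<length ms. min 1 (ms ! i)) = length ms"
    by (simp_all add: min_absorb1 Suc_leI)
  then show ?thesis
    using subgroup_exponents_eq[of 1 1] assms by simp
qed

lemma subgroup_rank_eq: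
  assumes "{x \<in> B. x [^] p = \<one>} \<subseteq> A"
  shows "rank (G\<lparr>carrier := A\<rparr>) = rank (G\<lparr>carrier := B\<rparr>)"
  using cyclic_decomposition_rank[OF subgroup_imp_group[OF A] p decA]
    cyclic_decomposition_rank[OF subgroup_imp_group[OF B] p decB] subgroup_exponents_length[OF assms]
  by simp

end

text \<open>Since the torsion up to level \<open>k\<close> agrees, the truncated sums agree up to
  \<open>k\<close>. At the last position where the lists differ, the exponent of \<open>A\<close> is
  therefore at least \<open>k\<close>, and \<open>var\<close> is \<open>p\<close> to that
  exponent.\<close>

lemma exponent_le_var:
  assumes p: "prime p" and A: "subgroup A G" and B: "subgroup B G" and AB: "A \<subseteq> B" "A \<noteq> B"
    and finB: "finite B"
    and decA: "cyclic_decomposition p (G\<lparr>carrier := A\<rparr>) (cyclic_exponents p (G\<lparr>carrier := A\<rparr>))"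
    and decB: "cyclic_decomposition p (G\<lparr>carrier := B\<rparr>) (cyclic_exponents p (G\<lparr>carrier := B\<rparr>))"
    and tors1: "{x \<in> B. x [^] p = \<one>} \<subseteq> A" and torsk: "{x \<in> B. x [^] (p ^ k) = \<one>} \<subseteq> A"
  shows "p ^ k \<le> var p G A B"
proof -
  let ?ns = "cyclic_exponents p (G\<lparr>carrier := A\<rparr>)" and ?ms = "cyclic_exponents p (G\<lparr>carrier := B\<rparr>)"
  note ctxt = p A B AB(1) finB decA decB
  have len: "length ?ms = length ?ns"
    using subgroup_exponents_length[OF ctxt tors1] by simp
  have sorted: "sorted_wrt (\<ge>) ?ns" "sorted_wrt (\<ge>) ?ms"
    using decA decB by (auto simp: cyclic_decomposition_def)
  have "?ns \<noteq> ?ms"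
  proof
    assume "?ns = ?ms"
    then have "card A = card B"
      using cyclic_decomposition_card[OF prime_gt_0_nat[OF p] decA]
        cyclic_decomposition_card[OF prime_gt_0_nat[OF p] decB] by simp
    then show False using AB finB by (metis card_subset_eq)
  qed
  then obtain r where r: "r < length ?ns" "?ns ! r < ?ms ! r"
    "\<And>j. r < j \<Longrightarrow> j < length ?ns \<Longrightarrow> ?ns ! j = ?ms ! j"
    using last_exponent_difference[OF sorted(1) len] subgroup_exponents_le[OF ctxt] len by metis
  \<comment> \<open>Of two different candidates the smaller one would have the larger one in its
    tail, where the lists must agree.\<close>
  have "(THE r. r < length ?ns \<and> ?ns ! r < ?ms ! r \<and>
      (\<forall>j. r < j \<and> j < length ?ns \<longrightarrow> ?ns ! j = ?ms ! j)) = r"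
  proof (rule the_equality)
    fix r' assume "r' < length ?ns \<and> ?ns ! r' < ?ms ! r' \<and>
      (\<forall>j. r' < j \<and> j < length ?ns \<longrightarrow> ?ns ! j = ?ms ! j)"
    then show "r' = r" using r by (metis less_irrefl linorder_neqE_nat)
  qed (use r in auto)
  then have "var p G A B = p ^ (?ns ! r)"
    using AB(2) by (simp add: var_def Let_def)
  moreover have "k \<le> ?ns ! r"
    using exponents_truncation[OF sorted(2) len _ r] subgroup_exponents_eq[OF ctxt torsk] len by simp
  ultimately show ?thesis
    using prime_gt_1_nat[OF p] by (simp add: power_increasing_iff)
qed

end

section \<open>Lower central series and center\<close>

lemma (in group) commutator_closed:
  "x \<in> carrier G \<Longrightarrow> y \<in> carrier G \<Longrightarrow> commutator G x y \<in> carrier G"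
  by (simp add: commutator_def)

lemma (in group) lower_central_subgroup: "subgroup (lower_central G n) G"
proof -
  \<comment> \<open>The induction starts at index 1, from which the recursion runs; the artificial
    index 0 is treated separately.\<close>
  have "subgroup (lower_central G (Suc k)) G" for k
  proof (induction k)
    case (Suc k)
    then have "{commutator G x y | x y. x \<in> lower_central G (Suc k) \<and> y \<in> carrier G} \<subseteq> carrier G"
      by (auto intro!: commutator_closed dest: subgroup.mem_carrier)
    then show ?case by (simp add: generate_is_subgroup)
  qed (simp add: subgroup_self)
  then show ?thesis by (cases n) (simp_all add: subgroup_self)
qed

lemma (in group) lower_central_carrier: "lower_central G n \<subseteq> carrier G"
  by (rule subgroup.subset[OF lower_central_subgroup])

text \<open>Together with \<open>lower_central_subset\<close> this restates the recursion with the
  indices \<open>n\<close> and \<open>n - 1\<close>, so that later proofs need not split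
  \<open>n\<close> into successors.\<close>

lemma (in group) commutator_in_lower_central:
  assumes "2 \<le> n" "x \<in> lower_central G (n - 1)" "y \<in> carrier G"
  shows "commutator G x y \<in> lower_central G n"
proof -
  obtain k where "n = Suc (Suc k)"
    using assms(1) by (metis Suc_le_D numeral_2_eq_2 Suc_le_mono)
  then show ?thesis using assms by (auto intro: generate.incl)
qed

lemma (in group) lower_central_subset:
  assumes "2 \<le> n" "subgroup H G"
    and "\<And>x y. x \<in> lower_central G (n - 1) \<Longrightarrow> y \<in> carrier G \<Longrightarrow> commutator G x y \<in> H"
  shows "lower_central G n \<subseteq> H"
proof -
  obtain k where "n = Suc (Suc k)"
    using assms(1) by (metis Suc_le_D numeral_2_eq_2 Suc_le_mono)
  then have "{commutator G x y | x y. x \<in> lower_central G (Suc k) \<and> y \<in> carrier G} \<subseteq> H"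
    using assms(3) by auto
  then show ?thesis
    using \<open>n = _\<close> by (simp add: generate_subgroup_incl[OF _ assms(2)])
qed

text \<open>\<open>commutator\<close> inverts its first two factors, the library's derived set its
  last two. Inverting both entries passes from one convention to the other.\<close>

lemma (in group) lower_central_2: "lower_central G 2 = derived G (carrier G)"
proof -
  have "\<exists>x y. h1 \<otimes> h2 \<otimes> inv h1 \<otimes> inv h2 = commutator G x y \<and> x \<in> carrier G \<and> y \<in> carrier G"
    if "h1 \<in> carrier G" "h2 \<in> carrier G" for h1 h2
    using that by (intro exI[of _ "inv h1"] exI[of _ "inv h2"]) (simp add: commutator_def)
  moreover have "commutator G x y \<in> derived_set G (carrier G)" if "x \<in> carrier G" "y \<in> carrier G" for x y
    using that unfolding commutator_def
    by (intro UN_I[of "inv x"] UN_I[of "inv y"]) simp_all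
  ultimately have "{commutator G x y | x y. x \<in> carrier G \<and> y \<in> carrier G} = derived_set G (carrier G)"
    by auto
  then show ?thesis by (simp add: numeral_2_eq_2 derived_def)
qed

lemma (in group) lower_central_le_2:
  assumes "2 \<le> n"
  shows "lower_central G n \<subseteq> lower_central G 2"
proof (rule lower_central_subset[OF assms lower_central_subgroup])
  fix x y assume "x \<in> lower_central G (n - 1)" "y \<in> carrier G"
  then show "commutator G x y \<in> lower_central G 2"
    using commutator_in_lower_central[of 2 x y] lower_central_carrier by auto
qed

lemma centerD:
  "z \<in> center G \<Longrightarrow> z \<in> carrier G"
  "z \<in> center G \<Longrightarrow> g \<in> carrier G \<Longrightarrow> z \<otimes>\<^bsub>G\<^esub> g = g \<otimes>\<^bsub>G\<^esub> z"
  by (auto simp: center_def)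

lemma (in group) subgroup_center: "subgroup (center G) G"
proof (rule subgroupI)
  show "inv a \<in> center G" if "a \<in> center G" for a
  proof -
    have "inv a \<otimes> g = g \<otimes> inv a" if "g \<in> carrier G" for g
    proof -
      have a: "a \<in> carrier G" and ag: "a \<otimes> g = g \<otimes> a"
        using centerD[OF \<open>a \<in> center G\<close>] that by auto
      have "inv a \<otimes> g = inv a \<otimes> (g \<otimes> a) \<otimes> inv a"
        using a that by (simp add: m_assoc)
      also have "\<dots> = inv a \<otimes> (a \<otimes> g) \<otimes> inv a"
        by (simp only: ag)
      also have "\<dots> = g \<otimes> inv a"
        using a that by (simp add: m_assoc[symmetric])
      finally show ?thesis .
    qed
    then show ?thesis using centerD(1)[OF that] by (simp add: center_def)
  qed
  show "a \<otimes> b \<in> center G" if "a \<in> center G" "b \<in> center G" for a b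
  proof -
    have "a \<otimes> b \<otimes> g = g \<otimes> (a \<otimes> b)" if "g \<in> carrier G" for g
    proof -
      have ab: "a \<in> carrier G" "b \<in> carrier G"
        using \<open>a \<in> center G\<close> \<open>b \<in> center G\<close> by (auto simp: center_def)
      have "a \<otimes> b \<otimes> g = a \<otimes> (g \<otimes> b)"
        using ab that centerD(2)[OF \<open>b \<in> center G\<close> that] by (simp add: m_assoc)
      also have "\<dots> = (g \<otimes> a) \<otimes> b"
        using ab that by (simp only: m_assoc[symmetric] centerD(2)[OF \<open>a \<in> center G\<close> that])
      finally show ?thesis using ab that by (simp add: m_assoc)
    qed
    moreover have "a \<in> carrier G" "b \<in> carrier G"
      using that by (auto simp: center_def)
    ultimately show ?thesis by (simp add: center_def)
  qed
  have "\<one> \<in> center G" by (simp add: center_def)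
  then show "center G \<noteq> {}" by auto
qed (auto simp: center_def)

lemma (in group) normal_center: "center G \<lhd> G"
proof (rule normal_invI[OF subgroup_center])
  fix x h assume x: "x \<in> carrier G" and h: "h \<in> center G"
  then have "x \<otimes> h \<otimes> inv x = h"
    using centerD(1)[OF h] by (simp add: m_assoc flip: centerD(2)[OF h x])
  then show "x \<otimes> h \<otimes> inv x \<in> center G" using h by simp
qed

lemma (in group) commutator_central_mult:
  assumes "a \<in> carrier G" "z \<in> center G" "y \<in> carrier G"
  shows "commutator G (a \<otimes> z) y = commutator G a y"
proof -
  have z: "z \<in> carrier G" "\<And>g. g \<in> carrier G \<Longrightarrow> inv z \<otimes> g = g \<otimes> inv z"
    using assms(2) subgroup.m_inv_closed[OF subgroup_center] by (auto simp: centerD)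
  have "commutator G (a \<otimes> z) y = inv z \<otimes> (inv a \<otimes> inv y \<otimes> a) \<otimes> z \<otimes> y"
    using assms z(1) by (simp add: commutator_def inv_mult_group m_assoc)
  also have "\<dots> = (inv a \<otimes> inv y \<otimes> a) \<otimes> (inv z \<otimes> z) \<otimes> y"
    using assms z by (simp add: m_assoc del: l_inv)
  finally show ?thesis using assms z(1) by (simp add: commutator_def)
qed

lemma (in group) commutator_eq_one_iff:
  assumes "x \<in> carrier G" "y \<in> carrier G"
  shows "commutator G x y = \<one> \<longleftrightarrow> x \<otimes> y = y \<otimes> x"
proof -
  have eq: "commutator G x y = inv (y \<otimes> x) \<otimes> (x \<otimes> y)"
    using assms by (simp add: commutator_def inv_mult_group m_assoc)
  show ?thesis
  proof
    assume one: "commutator G x y = \<one>"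
    have "x \<otimes> y = y \<otimes> x \<otimes> (inv (y \<otimes> x) \<otimes> (x \<otimes> y))"
      using assms by (simp only: m_assoc[symmetric] m_closed inv_closed r_inv l_one)
    also have "\<dots> = y \<otimes> x"
      using assms by (simp add: one flip: eq)
    finally show "x \<otimes> y = y \<otimes> x" .
  next
    assume "x \<otimes> y = y \<otimes> x"
    then show "commutator G x y = \<one>"
      using assms by (simp only: eq m_closed l_inv)
  qed
qed

text \<open>If \<open>G = \<gamma>\<^sub>2 Z\<close>, then every commutator has its first entry in \<open>\<gamma>\<^sub>2\<close> up to a central
  factor, so the lower central series is constant from \<open>\<gamma>\<^sub>2\<close> on.\<close>

lemma (in group) derived_center_proper:
  assumes "\<not> comm_group G" "2 \<le> n" and nil: "lower_central G n \<subseteq> center G"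
  shows "lower_central G 2 <#> center G \<noteq> carrier G"
proof
  assume eq: "lower_central G 2 <#> center G = carrier G"
  have *: "lower_central G 2 \<subseteq> lower_central G (Suc (Suc k))" for k
  proof (induction k)
    case (Suc k)
    have "commutator G x y \<in> lower_central G (Suc (Suc (Suc k)))"
      if x: "x \<in> lower_central G (2 - 1)" and y: "y \<in> carrier G" for x y
    proof -
      have "x \<in> lower_central G 2 <#> center G"
        using x by (simp add: eq)
      then obtain a z where a: "a \<in> lower_central G 2" and z: "z \<in> center G" and "x = a \<otimes> z"
        by (auto simp: set_mult_def)
      then have "commutator G x y = commutator G a y"
        using y lower_central_carrier by (auto intro: commutator_central_mult)
      then show ?thesis
        using commutator_in_lower_central[of "Suc (Suc (Suc k))" a y] a Suc.IH y by auto
    qed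
    then show ?case by (intro lower_central_subset lower_central_subgroup) auto
  qed (simp add: numeral_2_eq_2)
  \<comment> \<open>As \<open>\<gamma>\<^sub>n\<close> is central, the next term is trivial. Since
    \<open>\<gamma>\<^sub>2\<close> is contained in all later terms, it is trivial too, and
    \<open>G\<close> would be abelian.\<close>
  have "lower_central G (Suc n) \<subseteq> {\<one>}"
  proof (rule lower_central_subset[OF _ triv_subgroup])
    fix x y assume "x \<in> lower_central G (Suc n - 1)" "y \<in> carrier G"
    moreover from this have "x \<in> center G"
      using nil by auto
    ultimately show "commutator G x y \<in> {\<one>}"
      using centerD(2)[of x G y] by (simp add: commutator_eq_one_iff centerD(1))
  qed (use assms(2) in simp)
  moreover obtain k where "Suc n = Suc (Suc k)"
    using assms(2) by (cases n) auto
  ultimately have "lower_central G 2 \<subseteq> {\<one>}"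
    using *[of k] by simp
  then have one: "lower_central G 2 \<subseteq> {\<one>}" .
  have "x \<otimes> y = y \<otimes> x" if "x \<in> carrier G" "y \<in> carrier G" for x y
  proof -
    have "commutator G x y \<in> lower_central G 2"
      using commutator_in_lower_central[of 2 x y] that by simp
    then show ?thesis
      using one commutator_eq_one_iff[OF that] by auto
  qed
  then have "comm_group G"
    by (intro group_comm_groupI)
  then show False using assms(1) by contradiction
qed

section \<open>Abelian quotients\<close>

lemma (in group) normal_derived_supset:
  assumes "subgroup N G" "derived G (carrier G) \<subseteq> N"
  shows "N \<lhd> G"
proof (rule normal_invI[OF assms(1)])
  fix x h assume x: "x \<in> carrier G" and h: "h \<in> N"
  then have hG: "h \<in> carrier G" using subgroup.mem_carrier[OF assms(1)] by blast
  have "x \<otimes> h \<otimes> inv x \<otimes> inv h \<in> N"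
    using assms(2) x hG by (auto simp: derived_def intro: generate.incl)
  then have "x \<otimes> h \<otimes> inv x \<otimes> inv h \<otimes> h \<in> N"
    using h by (rule subgroup.m_closed[OF assms(1)])
  then show "x \<otimes> h \<otimes> inv x \<in> N"
    using x hG by (simp add: m_assoc)
qed

text \<open>The products \<open>x \<otimes> y\<close> and \<open>y \<otimes> x\<close> differ by a
  commutator, which \<open>N\<close> absorbs.\<close>

lemma (in group) comm_group_FactGroup_derived_supset:
  assumes N: "subgroup N G" and der: "derived G (carrier G) \<subseteq> N"
  shows "comm_group (G Mod N)"
proof (rule group.group_comm_groupI)
  interpret normal N G by (rule normal_derived_supset[OF assms])
  show "group (G Mod N)" by (rule factorgroup_is_group)
  fix X Y assume "X \<in> carrier (G Mod N)" "Y \<in> carrier (G Mod N)"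
  then obtain x y where xy: "x \<in> carrier G" "y \<in> carrier G" "X = N #> x" "Y = N #> y"
    by (auto simp: carrier_FactGroup)
  define c where "c = x \<otimes> y \<otimes> inv x \<otimes> inv y"
  have c: "c \<in> N" "c \<in> carrier G"
    using der xy by (auto simp: c_def derived_def intro: generate.incl)
  have "c = x \<otimes> y \<otimes> inv (y \<otimes> x)"
    using xy by (simp add: c_def inv_mult_group m_assoc)
  then have "x \<otimes> y = c \<otimes> (y \<otimes> x)"
    using inv_solve_right[of c "x \<otimes> y" "y \<otimes> x"] c xy by simp
  then have "N #> (x \<otimes> y) = (N #> c) #> (y \<otimes> x)"
    using xy c subset by (simp add: coset_mult_assoc)
  then have "N #> (x \<otimes> y) = N #> (y \<otimes> x)"
    using coset_join2[OF c(2) N c(1)] by simp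
  then show "X \<otimes>\<^bsub>G Mod N\<^esub> Y = Y \<otimes>\<^bsub>G Mod N\<^esub> X"
    using xy by (simp add: rcos_sum)
qed

section \<open>Central automorphisms\<close>

lemma (in group) int_pow_mod:
  assumes "z \<in> carrier G" "z [^] (q::nat) = \<one>"
  shows "z [^] (i mod int q) = z [^] i"
proof -
  have "z [^] i = z [^] (int q * (i div int q) + i mod int q)"
    by simp
  also have "\<dots> = (z [^] int q) [^] (i div int q) \<otimes> z [^] (i mod int q)"
    using assms(1) by (simp only: int_pow_mult int_pow_pow)
  finally show ?thesis
    using assms by (simp add: int_pow_int)
qed

text \<open>Exponentiation turns a character into a homomorphism with values in the powers of
  \<open>z\<close>; reduction modulo \<open>q\<close> is harmless because \<open>z [^] q\<close> is
  trivial.\<close>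

lemma (in group) hom_pow_of_integer_mod_group:
  assumes "\<phi> \<in> hom H (integer_mod_group q)" "z \<in> carrier G" "z [^] q = \<one>"
  shows "(\<lambda>g. z [^] \<phi> g) \<in> hom H G"
  using assms by (auto simp: hom_def int_pow_mod int_pow_mult)

text \<open>The character is the first coordinate of a cyclic decomposition of
  \<open>G Mod N\<close>, and \<open>q\<close> represents the first unit vector. As the list is
  decreasing, \<open>k\<close> is its largest entry, so \<open>p ^ k\<close> kills the whole
  quotient.\<close>

lemma (in group) quotient_character:
  assumes p: "prime p" and fin: "finite (carrier G)" and ord: "order G = p ^ m"
    and N: "subgroup N G" and der: "derived G (carrier G) \<subseteq> N"
  obtains k \<phi> q where "\<phi> \<in> hom G (integer_mod_group (p ^ k))" "\<And>x. x \<in> N \<Longrightarrow> \<phi> x = 0"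
    "q \<in> carrier G" "\<phi> q = 1 mod int (p ^ k)" "\<And>g. g \<in> carrier G \<Longrightarrow> g [^] (p ^ k) \<in> N"
proof -
  interpret N: normal N G by (rule normal_derived_supset[OF N der])
  let ?H = "G Mod N"
  interpret H: comm_group ?H by (rule comm_group_FactGroup_derived_supset[OF N der])
  have finH: "finite (carrier ?H)"
    using fin by (simp add: carrier_FactGroup)
  have "card (carrier ?H) dvd p ^ m"
    using lagrange[OF N] ord by (metis FactGroup_def dvd_triv_left partial_object.select_convs(1))
  then obtain m' where "card (carrier ?H) = p ^ m'"
    using divides_primepow_nat[OF p] by blast
  then obtain ns where dec: "cyclic_decomposition p ?H ns"
    using cyclic_decomposition_exists[OF p H.comm_group_axioms finH] by blast
  show thesis
  proof (cases "ns = []")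
    case True
    then have "card (carrier ?H) = 1"
      using cyclic_decomposition_card[OF prime_gt_0_nat[OF p] dec] by simp
    then have "carrier ?H = {N}"
      using H.one_closed by (metis card_1_singletonE one_FactGroup singletonD)
    then have "carrier G \<subseteq> N"
      using rcos_self[OF _ N] by (auto simp: carrier_FactGroup)
    \<comment> \<open>For a trivial quotient \<open>k = 0\<close> and the character is zero. The
      value \<open>1 mod int (p ^ k)\<close> is then 0, which explains its form in the
      conclusion.\<close>
    then show ?thesis
      by (intro that[of "\<lambda>_. 0" 0 \<one>]) (auto simp: hom_def)
  next
    case False
    define k where "k = ns ! 0"
    have pos: "\<forall>k\<in>set ns. 0 < k" and "?H \<cong> cyclic_product p ns" and sorted: "sorted_wrt (\<ge>) ns"
      using dec by (auto simp: cyclic_decomposition_def)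
    then obtain h where h: "h \<in> hom ?H (cyclic_product p ns)"
      "bij_betw h (carrier ?H) (carrier (cyclic_product p ns))"
      by (auto simp: is_iso_def iso_def)
    interpret h: group_hom ?H "cyclic_product p ns" h
      using h(1) by (simp add: group_hom_def group_hom_axioms_def H.group_axioms)
    let ?\<phi> = "\<lambda>g. h (N #> g) 0"
    have coset: "N #> g \<in> carrier ?H" if "g \<in> carrier G" for g
      using that by (auto simp: carrier_FactGroup)
    have "?\<phi> \<in> hom G (integer_mod_group (p ^ k))"
    proof (rule homI)
      fix x assume "x \<in> carrier G"
      then show "?\<phi> x \<in> carrier (integer_mod_group (p ^ k))"
        using h.hom_closed[OF coset] False by (auto simp: PiE_iff k_def)
    next
      fix x y assume xy: "x \<in> carrier G" "y \<in> carrier G"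
      have "h (N #> (x \<otimes> y)) = h (N #> x) \<otimes>\<^bsub>cyclic_product p ns\<^esub> h (N #> y)"
        using h.hom_mult[OF coset coset, of x y] xy by (simp add: N.rcos_sum)
      then show "?\<phi> (x \<otimes> y) = ?\<phi> x \<otimes>\<^bsub>integer_mod_group (p ^ k)\<^esub> ?\<phi> y"
        using False by (simp add: k_def)
    qed
    moreover have "?\<phi> x = 0" if "x \<in> N" for x
    proof -
      have "N #> x = \<one>\<^bsub>?H\<^esub>"
        using that coset_join2[OF _ N that] N.subset by auto
      then have "h (N #> x) = \<one>\<^bsub>cyclic_product p ns\<^esub>"
        by (metis h.hom_one)
      then show ?thesis using False by simp
    qed
    moreover obtain q where q: "q \<in> carrier G" "h (N #> q) = unit_vector (length ns) 0"
    proof -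
      have "unit_vector (length ns) 0 \<in> h ` carrier ?H"
        using bij_betw_imp_surj_on[OF h(2)] unit_vector_carrier[OF p pos] by blast
      then show ?thesis using that by (auto simp: carrier_FactGroup)
    qed
    moreover have "?\<phi> q = 1 mod int (p ^ k)"
    proof -
      have "0 < k"
        using pos False by (auto simp: k_def)
      then have "1 < p ^ k"
        by (rule one_less_power[OF prime_gt_1_nat[OF p]])
      then have "1 mod int (p ^ k) = 1"
        by (metis mod_pos_pos_trivial of_nat_1 of_nat_less_iff zero_le_one)
      then show ?thesis
        using False by (simp add: q(2) unit_vector_def)
    qed
    moreover have "g [^] (p ^ k) \<in> N" if g: "g \<in> carrier G" for g
    proof -
      have "h (N #> g) [^]\<^bsub>cyclic_product p ns\<^esub> (p ^ k) = \<one>\<^bsub>cyclic_product p ns\<^esub>"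
      proof -
        have "int (p ^ (ns ! i)) dvd int (p ^ k)" if "i < length ns" for i
          using sorted that by (cases "i = 0") (auto simp: k_def sorted_wrt_iff_nth_less le_imp_power_dvd)
        then have "int (p ^ k) * h (N #> g) i mod int (p ^ (ns ! i)) = 0" if "i < length ns" for i
          using that by (meson dvd_eq_mod_eq_0 dvd_mult2)
        then show ?thesis
          unfolding pow_product_group[OF h.hom_closed[OF coset[OF g]]] one_product_group
          by (intro restrict_ext) simp
      qed
      then have "h ((N #> g) [^]\<^bsub>?H\<^esub> (p ^ k)) = h \<one>\<^bsub>?H\<^esub>"
        using h.hom_nat_pow[OF coset[OF g]] h.hom_one by metis
      then have "(N #> g) [^]\<^bsub>?H\<^esub> (p ^ k) = \<one>\<^bsub>?H\<^esub>"
        using inj_onD[OF bij_betw_imp_inj_on[OF h(2)]] H.nat_pow_closed[OF coset[OF g]] H.one_closed by metis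
      then have "N #> (g [^] (p ^ k)) = N"
        using N.FactGroup_pow[OF g] by simp
      then show ?thesis
        using g by (intro coset_join1[OF _ _ N]) auto
    qed
    ultimately show ?thesis by (intro that[of ?\<phi> k q])
  qed
qed

section \<open>Central automorphisms as homomorphisms into the center\<close>

lemma Autcent_extensional: "\<alpha> \<in> Autcent G \<Longrightarrow> \<alpha> \<in> extensional (carrier G)"
  by (simp add: Autcent_def auto_def Bij_def)

text \<open>The map is multiplicative because the values of \<open>f\<close> commute with
  everything. The condition \<open>inj\<close> says that its kernel is trivial, and finiteness then
  gives surjectivity.\<close>

lemma (in group) central_auto_of_hom:
  assumes fin: "finite (carrier G)" and f: "f \<in> hom G G"
    and cent: "\<And>g. g \<in> carrier G \<Longrightarrow> f g \<in> center G"
    and inj: "\<And>g. g \<in> carrier G \<Longrightarrow> g \<otimes> f g = \<one> \<Longrightarrow> g = \<one>"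
  shows "(\<lambda>g\<in>carrier G. g \<otimes> f g) \<in> Autcent G"
proof -
  let ?\<alpha> = "\<lambda>g\<in>carrier G. g \<otimes> f g"
  have fG: "f g \<in> carrier G" if "g \<in> carrier G" for g
    using cent[OF that] by (rule centerD(1))
  have hom: "?\<alpha> \<in> hom G G"
  proof (rule homI)
    fix x y assume x: "x \<in> carrier G" and y: "y \<in> carrier G"
    have "x \<otimes> y \<otimes> f (x \<otimes> y) = x \<otimes> (y \<otimes> f x) \<otimes> f y"
      using x y fG f by (simp add: hom_mult m_assoc)
    also have "y \<otimes> f x = f x \<otimes> y"
      using centerD(2)[OF cent[OF x] y] by simp
    finally show "?\<alpha> (x \<otimes> y) = ?\<alpha> x \<otimes> ?\<alpha> y"
      using x y fG by (simp add: m_assoc)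
  qed (use fG in simp)
  have "inj_on ?\<alpha> (carrier G)"
    using inj_on_one_iff'[OF hom group_axioms group_axioms] inj by simp
  moreover have "?\<alpha> ` carrier G \<subseteq> carrier G"
    using fG by auto
  ultimately have "bij_betw ?\<alpha> (carrier G) (carrier G)"
    using endo_inj_surj[OF fin] by (auto simp: bij_betw_def)
  then have "?\<alpha> \<in> auto G"
    using hom by (simp add: auto_def Bij_def)
  moreover have "inv g \<otimes> ?\<alpha> g \<in> center G" if "g \<in> carrier G" for g
    using that fG cent by (simp add: m_assoc[symmetric])
  ultimately show ?thesis by (simp add: Autcent_def)
qed

text \<open>Reverses \<open>central_auto_of_hom\<close>: the central element
  \<open>inv x \<otimes> \<alpha> x\<close> can be moved past \<open>inv y\<close>.\<close>

lemma (in group) Autcent_hom: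
  assumes "\<alpha> \<in> Autcent G"
  shows "(\<lambda>g. inv g \<otimes> \<alpha> g) \<in> hom G G"
proof (rule homI)
  have \<alpha>: "\<alpha> \<in> hom G G" and cent: "\<And>g. g \<in> carrier G \<Longrightarrow> inv g \<otimes> \<alpha> g \<in> center G"
    using assms by (auto simp: Autcent_def auto_def)
  have \<alpha>G: "\<alpha> g \<in> carrier G" if "g \<in> carrier G" for g
    using \<alpha> that by (rule hom_in_carrier)
  show "inv g \<otimes> \<alpha> g \<in> carrier G" if "g \<in> carrier G" for g
    using that \<alpha>G by simp
  fix x y assume x: "x \<in> carrier G" and y: "y \<in> carrier G"
  have "inv (x \<otimes> y) \<otimes> \<alpha> (x \<otimes> y) = inv y \<otimes> (inv x \<otimes> \<alpha> x) \<otimes> \<alpha> y"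
    using x y \<alpha>G hom_mult[OF \<alpha>] by (simp add: inv_mult_group m_assoc)
  also have "inv y \<otimes> (inv x \<otimes> \<alpha> x) = inv x \<otimes> \<alpha> x \<otimes> inv y"
    using centerD(2)[OF cent[OF x], of "inv y"] y by simp
  finally show "inv (x \<otimes> y) \<otimes> \<alpha> (x \<otimes> y) = inv x \<otimes> \<alpha> x \<otimes> (inv y \<otimes> \<alpha> y)"
    using x y \<alpha>G by (simp add: m_assoc)
qed

text \<open>Values in the center commute, so every commutator lies in the kernel.\<close>

lemma (in group) hom_center_derived:
  assumes f: "f \<in> hom G G" and cent: "\<And>g. g \<in> carrier G \<Longrightarrow> f g \<in> center G"
    and x: "x \<in> derived G (carrier G)"
  shows "f x = \<one>"
proof -
  interpret f: group_hom G G f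
    using f by (simp add: group_hom_def group_hom_axioms_def group_axioms)
  have "f (a \<otimes> b \<otimes> inv a \<otimes> inv b) = \<one>" if a: "a \<in> carrier G" and b: "b \<in> carrier G" for a b
  proof -
    have "f (a \<otimes> b \<otimes> inv a \<otimes> inv b) = f a \<otimes> f b \<otimes> inv (f a) \<otimes> inv (f b)"
      using a b by simp
    also have "f a \<otimes> f b = f b \<otimes> f a"
      using centerD(2)[OF cent[OF a]] b by simp
    finally show ?thesis using a b by (simp add: m_assoc)
  qed
  then have "derived_set G (carrier G) \<subseteq> kernel G G f"
    by (auto simp: kernel_def)
  then have "derived G (carrier G) \<subseteq> kernel G G f"
    unfolding derived_def by (rule generate_subgroup_incl[OF _ f.subgroup_kernel])
  then show ?thesis using x by (auto simp: kernel_def)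
qed

text \<open>Inverts a bijective homomorphism using closure of \<open>H\<close> as the only algebraic
  fact about it, so for \<open>Hom_group\<close> a proof of closure suffices.\<close>

lemma is_iso_of_bij_hom:
  assumes h: "h \<in> hom H G" and bij: "bij_betw h (carrier H) (carrier G)"
    and closed: "\<And>x y. x \<in> carrier H \<Longrightarrow> y \<in> carrier H \<Longrightarrow> x \<otimes>\<^bsub>H\<^esub> y \<in> carrier H"
  shows "G \<cong> H"
proof (rule is_isoI[OF isoI])
  let ?g = "inv_into (carrier H) h"
  show bij': "bij_betw ?g (carrier G) (carrier H)"
    using bij by (rule bij_betw_inv_into)
  show "?g \<in> hom G H"
  proof (rule homI)
    show g: "?g x \<in> carrier H" if "x \<in> carrier G" for x
      using bij' that by (rule bij_betw_apply)
    fix x y assume "x \<in> carrier G" "y \<in> carrier G"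
    then show "?g (x \<otimes>\<^bsub>G\<^esub> y) = ?g x \<otimes>\<^bsub>H\<^esub> ?g y"
      using g bij h closed
      by (intro inv_into_f_eq) (auto simp: hom_mult bij_betw_inv_into_right bij_betw_imp_inj_on)
  qed
qed

text \<open>That central automorphisms fix the center pointwise is what lets
  \<open>inv g \<otimes> \<alpha> g\<close> depend only on the coset of \<open>g\<close>, and hence
  makes \<open>\<Theta>\<close> surjective.\<close>

lemma (in group) Hom_group_Autcent_bij:
  assumes fin: "finite (carrier G)" and fixed: "\<And>\<alpha> z. \<alpha> \<in> Autcent G \<Longrightarrow> z \<in> center G \<Longrightarrow> \<alpha> z = z"
  defines "\<Theta> \<equiv> (\<lambda>f. \<lambda>g\<in>carrier G. g \<otimes> f (center G #> g))"
  shows "bij_betw \<Theta> (carrier (Hom_group (G Mod center G) (G\<lparr>carrier := center G\<rparr>))) (Autcent G)"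
proof -
  interpret Z: normal "center G" G by (rule normal_center)
  let ?Q = "G Mod center G" and ?Z = "G\<lparr>carrier := center G\<rparr>"
  let ?H = "Hom_group ?Q ?Z"
  have coset: "center G #> g \<in> carrier ?Q" if "g \<in> carrier G" for g
    using that by (auto simp: carrier_FactGroup)
  have comp: "(\<lambda>g. f (center G #> g)) \<in> hom G G" and cent: "\<And>g. g \<in> carrier G \<Longrightarrow> f (center G #> g) \<in> center G"
    and one: "\<And>z. z \<in> center G \<Longrightarrow> f (center G #> z) = \<one>" if "f \<in> carrier ?H" for f
  proof -
    have f: "f \<in> hom ?Q ?Z" using that by (simp add: Hom_group_def)
    show c: "f (center G #> g) \<in> center G" if "g \<in> carrier G" for g
      using hom_in_carrier[OF f coset[OF that]] by simp
    show "(\<lambda>g. f (center G #> g)) \<in> hom G G"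
    proof (rule homI)
      show "f (center G #> x) \<in> carrier G" if "x \<in> carrier G" for x
        using c[OF that] by (rule centerD(1))
      show "f (center G #> (x \<otimes> y)) = f (center G #> x) \<otimes> f (center G #> y)"
        if "x \<in> carrier G" "y \<in> carrier G" for x y
        using hom_mult[OF f coset coset, of x y] that by (simp add: Z.rcos_sum)
    qed
    show "f (center G #> z) = \<one>" if "z \<in> center G" for z
    proof -
      have "f \<one>\<^bsub>?Q\<^esub> = \<one>\<^bsub>?Z\<^esub>"
        using f Z.factorgroup_is_group subgroup_imp_group[OF subgroup_center] by (rule hom_one)
      then show ?thesis
        using coset_join2[OF centerD(1)[OF that] subgroup_center that] by simp
    qed
  qed
  have into: "\<Theta> f \<in> Autcent G" if f: "f \<in> carrier ?H" for f
    unfolding \<Theta>_def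
  proof (rule central_auto_of_hom[OF fin comp[OF f] cent[OF f]])
    \<comment> \<open>An element of the kernel is the inverse of a central element, so it is
      central. Its coset is then the identity of the quotient, where \<open>f\<close> is
      trivial.\<close>
    fix g assume g: "g \<in> carrier G" and eq: "g \<otimes> f (center G #> g) = \<one>"
    have c: "f (center G #> g) \<in> center G" by (rule cent[OF f g])
    then have "g = inv (f (center G #> g))"
      using eq g centerD(1)[OF c] by (metis inv_equality inv_inv inv_closed)
    then have "g \<in> center G"
      using subgroup.m_inv_closed[OF subgroup_center c] by simp
    then show "g = \<one>"
      using eq g one[OF f] by simp
  qed
  have "inj_on \<Theta> (carrier ?H)"
  proof (rule inj_onI)
    fix f f' assume f: "f \<in> carrier ?H" and f': "f' \<in> carrier ?H" and eq: "\<Theta> f = \<Theta> f'"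
    show "f = f'"
    proof (rule extensionalityI)
      show "f \<in> extensional (carrier ?Q)" "f' \<in> extensional (carrier ?Q)"
        using f f' by (simp_all add: Hom_group_def)
      fix X assume "X \<in> carrier ?Q"
      then obtain g where g: "g \<in> carrier G" "X = center G #> g"
        by (auto simp: carrier_FactGroup)
      have "g \<otimes> f X = g \<otimes> f' X"
        using fun_cong[OF eq, of g] g by (simp add: \<Theta>_def)
      moreover have "f X \<in> carrier G" "f' X \<in> carrier G"
        using centerD(1)[OF cent[OF f g(1)]] centerD(1)[OF cent[OF f' g(1)]] g(2) by simp_all
      ultimately show "f X = f' X"
        using g(1) by simp
    qed
  qed
  moreover have "\<alpha> \<in> \<Theta> ` carrier ?H" if \<alpha>: "\<alpha> \<in> Autcent G" for \<alpha>
  proof -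
    let ?F = "\<lambda>g. inv g \<otimes> \<alpha> g"
    have \<alpha>G: "\<alpha> g \<in> carrier G" and F: "?F g \<in> center G" if "g \<in> carrier G" for g
      using \<alpha> that by (auto simp: Autcent_def auto_def hom_in_carrier)
    have homF: "?F \<in> hom G ?Z"
      using Autcent_hom[OF \<alpha>] F by (auto simp: hom_def)
    interpret F: group_hom G ?Z ?F
      using homF by (simp add: group_hom_def group_hom_axioms_def group_axioms subgroup_imp_group subgroup_center)
    have "?F x = ?F y" if x: "x \<in> carrier G" and y: "y \<in> carrier G" and eq: "center G #> x = center G #> y" for x y
    proof -
      have "x \<in> center G #> y"
        using rcos_self[OF x subgroup_center] eq by simp
      then obtain z where z: "z \<in> center G" "x = z \<otimes> y"
        by (auto simp: r_coset_def)
      have "?F x = ?F z \<otimes> ?F y"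
        using hom_mult[OF homF centerD(1)[OF z(1)] y] z(2) by simp
      also have "?F z = \<one>"
        using fixed[OF \<alpha> z(1)] centerD(1)[OF z(1)] by simp
      finally show ?thesis
        using y \<alpha>G by simp
    qed
    then obtain f where f: "f \<in> hom ?Q ?Z" "\<And>g. g \<in> carrier G \<Longrightarrow> f (center G #> g) = ?F g"
      using FactGroup_universal[OF homF normal_center] by blast
    have "restrict f (carrier ?Q) \<in> hom ?Q ?Z"
      by (rule group.hom_eq[OF Z.factorgroup_is_group f(1)]) simp
    then have "restrict f (carrier ?Q) \<in> carrier ?H"
      by (simp add: Hom_group_def)
    moreover have "\<alpha> = \<Theta> (restrict f (carrier ?Q))"
    proof (rule extensionalityI[of _ "carrier G"])
      show "\<alpha> \<in> extensional (carrier G)" using \<alpha> by (rule Autcent_extensional)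
      fix g assume g: "g \<in> carrier G"
      then have "g \<otimes> ?F g = \<alpha> g"
        using \<alpha>G by (simp add: m_assoc[symmetric])
      then show "\<alpha> g = \<Theta> (restrict f (carrier ?Q)) g"
        using g f(2) coset by (simp add: \<Theta>_def)
    qed (simp add: \<Theta>_def)
    ultimately show ?thesis by blast
  qed
  ultimately show ?thesis
    using into by (auto simp: bij_betw_def)
qed

text \<open>Under the bijection, composition becomes the pointwise product: multiplying
  \<open>g\<close> by a central value does not change its coset modulo the center.\<close>

lemma (in group) Autcent_iso_Hom_group:
  assumes fin: "finite (carrier G)" and fixed: "\<And>\<alpha> z. \<alpha> \<in> Autcent G \<Longrightarrow> z \<in> center G \<Longrightarrow> \<alpha> z = z"
  shows "(AutoGroup G)\<lparr>carrier := Autcent G\<rparr> \<cong> Hom_group (G Mod center G) (G\<lparr>carrier := center G\<rparr>)"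
proof -
  interpret Z: normal "center G" G by (rule normal_center)
  interpret Q: group "G Mod center G" by (rule Z.factorgroup_is_group)
  let ?Q = "G Mod center G" and ?Z = "G\<lparr>carrier := center G\<rparr>"
  let ?H = "Hom_group ?Q ?Z"
  let ?\<Theta> = "\<lambda>f. \<lambda>g\<in>carrier G. g \<otimes> f (center G #> g)"
  have bij: "bij_betw ?\<Theta> (carrier ?H) (Autcent G)"
    using fixed by (intro Hom_group_Autcent_bij[OF fin])
  have coset: "center G #> g \<in> carrier ?Q" if "g \<in> carrier G" for g
    using that by (auto simp: carrier_FactGroup)
  have mult: "f \<otimes>\<^bsub>?H\<^esub> f' = (\<lambda>X\<in>carrier ?Q. f X \<otimes> f' X)" for f f'
    by (simp add: Hom_group_def)
  have cent: "f X \<in> center G" if "f \<in> carrier ?H" "X \<in> carrier ?Q" for f X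
    using that by (auto simp: Hom_group_def hom_def)
  have closed: "f \<otimes>\<^bsub>?H\<^esub> f' \<in> carrier ?H" if f: "f \<in> carrier ?H" and f': "f' \<in> carrier ?H" for f f'
  proof -
    have "(\<lambda>X\<in>carrier ?Q. f X \<otimes> f' X) \<in> hom ?Q ?Z"
    proof (rule homI)
      fix X Y assume X: "X \<in> carrier ?Q" and Y: "Y \<in> carrier ?Q"
      have "f (X \<otimes>\<^bsub>?Q\<^esub> Y) = f X \<otimes> f Y" "f' (X \<otimes>\<^bsub>?Q\<^esub> Y) = f' X \<otimes> f' Y"
        using f f' X Y by (auto simp: Hom_group_def hom_def)
      moreover have "f X \<otimes> f Y \<otimes> (f' X \<otimes> f' Y) = f X \<otimes> f' X \<otimes> (f Y \<otimes> f' Y)"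
      proof -
        have G: "f X \<in> carrier G" "f Y \<in> carrier G" "f' X \<in> carrier G" "f' Y \<in> carrier G"
          using cent f f' X Y centerD(1) by metis+
        have "f X \<otimes> f Y \<otimes> (f' X \<otimes> f' Y) = f X \<otimes> (f Y \<otimes> f' X) \<otimes> f' Y"
          using G by (simp add: m_assoc)
        also have "f Y \<otimes> f' X = f' X \<otimes> f Y"
          using centerD(2)[OF cent[OF f Y] G(3)] .
        finally show ?thesis using G by (simp add: m_assoc)
      qed
      ultimately show "(\<lambda>X\<in>carrier ?Q. f X \<otimes> f' X) (X \<otimes>\<^bsub>?Q\<^esub> Y)
          = (\<lambda>X\<in>carrier ?Q. f X \<otimes> f' X) X \<otimes>\<^bsub>?Z\<^esub> (\<lambda>X\<in>carrier ?Q. f X \<otimes> f' X) Y"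
        using X Y Q.m_closed[OF X Y] by simp
    qed (use cent f f' subgroup.m_closed[OF subgroup_center] in simp)
    then show ?thesis
      unfolding mult by (simp add: Hom_group_def)
  qed
  have "?\<Theta> (f \<otimes>\<^bsub>?H\<^esub> f') = compose (carrier G) (?\<Theta> f) (?\<Theta> f')" if f: "f \<in> carrier ?H" and f': "f' \<in> carrier ?H" for f f'
  proof (rule extensionalityI[of _ "carrier G"])
    fix g assume g: "g \<in> carrier G"
    let ?X = "center G #> g"
    have fG: "f ?X \<in> carrier G" and f'G: "f' ?X \<in> carrier G"
      using centerD(1)[OF cent[OF f coset[OF g]]] centerD(1)[OF cent[OF f' coset[OF g]]] .
    have "center G #> (g \<otimes> f' ?X) = center G #> (f' ?X \<otimes> g)"
      using centerD(2)[OF cent[OF f' coset[OF g]] g] by simp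
    also have "\<dots> = (center G #> f' ?X) #> g"
      using g f'G by (simp add: coset_mult_assoc Z.subset)
    also have "\<dots> = ?X"
      using coset_join2[OF f'G subgroup_center cent[OF f' coset[OF g]]] by simp
    finally have X: "center G #> (g \<otimes> f' ?X) = ?X" .
    have "?\<Theta> (f \<otimes>\<^bsub>?H\<^esub> f') g = g \<otimes> (f ?X \<otimes> f' ?X)"
      using g coset[OF g] by (simp add: mult)
    also have "f ?X \<otimes> f' ?X = f' ?X \<otimes> f ?X"
      using centerD(2)[OF cent[OF f coset[OF g]] f'G] .
    also have "g \<otimes> (f' ?X \<otimes> f ?X) = compose (carrier G) (?\<Theta> f) (?\<Theta> f') g"
      using g fG f'G X by (simp add: compose_def m_assoc)
    finally show "?\<Theta> (f \<otimes>\<^bsub>?H\<^esub> f') g = compose (carrier G) (?\<Theta> f) (?\<Theta> f') g" .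
  qed (simp_all add: compose_def)
  moreover have "\<alpha> \<otimes>\<^bsub>(AutoGroup G)\<lparr>carrier := Autcent G\<rparr>\<^esub> \<beta> = compose (carrier G) \<alpha> \<beta>"
    if "\<alpha> \<in> Autcent G" "\<beta> \<in> Autcent G" for \<alpha> \<beta>
    using that by (simp add: AutoGroup_def BijGroup_def Autcent_def auto_def)
  ultimately have "?\<Theta> \<in> hom ?H ((AutoGroup G)\<lparr>carrier := Autcent G\<rparr>)"
    using bij_betw_apply[OF bij] by (intro homI) simp_all
  then show ?thesis
    using bij closed by (intro is_iso_of_bij_hom) simp_all
qed

section \<open>Exponents and the automorphisms in \<open>Autc\<close>\<close>

lemma exponent_properties:
  assumes "group K" "finite (carrier K)"
  shows "0 < exponent K" "g \<in> carrier K \<Longrightarrow> g [^]\<^bsub>K\<^esub> exponent K = \<one>\<^bsub>K\<^esub>"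
proof -
  interpret group K by fact
  have "0 < order K \<and> (\<forall>g\<in>carrier K. g [^]\<^bsub>K\<^esub> order K = \<one>\<^bsub>K\<^esub>)"
    using assms(2) by (simp add: order_gt_0_iff_finite pow_order_eq_1)
  then have "0 < exponent K \<and> (\<forall>g\<in>carrier K. g [^]\<^bsub>K\<^esub> exponent K = \<one>\<^bsub>K\<^esub>)"
    unfolding exponent_def by (rule LeastI)
  then show "0 < exponent K" "g \<in> carrier K \<Longrightarrow> g [^]\<^bsub>K\<^esub> exponent K = \<one>\<^bsub>K\<^esub>"
    by auto
qed

lemma exponent_le:
  assumes "0 < e" "\<And>g. g \<in> carrier K \<Longrightarrow> g [^]\<^bsub>K\<^esub> e = \<one>\<^bsub>K\<^esub>"
  shows "exponent K \<le> e"
  unfolding exponent_def using assms by (intro Least_le) simp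

lemma (in group) inner_auto:
  assumes x: "x \<in> carrier G"
  shows "(\<lambda>g\<in>carrier G. inv x \<otimes> g \<otimes> x) \<in> auto G"
proof -
  have cancel: "x \<otimes> (inv x \<otimes> y) = y" "inv x \<otimes> (x \<otimes> y) = y" if "y \<in> carrier G" for y
    using x that by (simp_all add: m_assoc[symmetric])
  have "bij_betw (\<lambda>g\<in>carrier G. inv x \<otimes> g \<otimes> x) (carrier G) (carrier G)"
    using x by (intro bij_betwI[where g = "\<lambda>g. x \<otimes> g \<otimes> inv x"]) (auto simp: m_assoc cancel)
  moreover have "(\<lambda>g\<in>carrier G. inv x \<otimes> g \<otimes> x) \<in> hom G G"
    using x by (intro homI) (simp_all add: m_assoc cancel)
  ultimately show ?thesis
    by (simp add: auto_def Bij_def)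
qed

text \<open>The displacement is the inverse of the commutator of \<open>x\<close> and
  \<open>g\<close>; taking \<open>x\<close> from term \<open>n - 1\<close> puts it into term
  \<open>n\<close>.\<close>

lemma (in group) Autc_commutator:
  assumes "2 \<le> n" "\<beta> \<in> Autc G (n - 1)" "g \<in> carrier G"
  shows "inv g \<otimes> \<beta> g \<in> lower_central G n"
proof -
  obtain x where x: "x \<in> lower_central G (n - 1)" and "\<beta> g = inv x \<otimes> g \<otimes> x"
    using assms by (auto simp: Autc_def)
  moreover have xG: "x \<in> carrier G"
    using x lower_central_carrier by blast
  ultimately have "inv g \<otimes> \<beta> g = inv (commutator G x g)"
    using assms(3) by (simp add: commutator_def inv_mult_group m_assoc)
  then show ?thesis
    using subgroup.m_inv_closed[OF lower_central_subgroup commutator_in_lower_central[OF assms(1) x assms(3)]]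
    by simp
qed

text \<open>Conjugation by an element \<open>x\<close> of term \<open>n - 1\<close> belongs to
  \<open>Autc\<close>, with the same \<open>x\<close> for every \<open>g\<close>. Being a central
  automorphism, it makes all commutators with \<open>x\<close> central.\<close>

lemma (in group) lower_central_central_of_Autc:
  assumes n: "2 \<le> n" and sub: "Autc G (n - 1) \<subseteq> Autcent G"
  shows "lower_central G n \<subseteq> center G"
proof (rule lower_central_subset[OF n subgroup_center])
  fix x y assume x: "x \<in> lower_central G (n - 1)" and y: "y \<in> carrier G"
  have xG: "x \<in> carrier G" using x lower_central_carrier by blast
  have "(\<lambda>g\<in>carrier G. inv x \<otimes> g \<otimes> x) \<in> Autc G (n - 1)"
    using inner_auto[OF xG] x by (auto simp: Autc_def)
  then have "inv y \<otimes> (inv x \<otimes> y \<otimes> x) \<in> center G"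
    using sub y by (auto simp: Autcent_def)
  then have "inv (inv y \<otimes> (inv x \<otimes> y \<otimes> x)) \<in> center G"
    by (rule subgroup.m_inv_closed[OF subgroup_center])
  then show "commutator G x y \<in> center G"
    using xG y by (simp add: commutator_def inv_mult_group m_assoc)
qed

text \<open>The central automorphism \<open>g \<mapsto> g z\<^bsup>\<phi>(g)\<^esup>\<close> sends \<open>q\<close> to \<open>q z\<close>.\<close>

lemma (in group) character_imp_lower_central:
  assumes n: "2 \<le> n" and fin: "finite (carrier G)" and sub: "Autcent G \<subseteq> Autc G (n - 1)"
    and z: "z \<in> center G" "z [^] m = \<one>"
    and \<phi>: "\<phi> \<in> hom G (integer_mod_group m)" and q: "q \<in> carrier G" "\<phi> q = 1 mod int m"
    and inj: "\<And>g. g \<in> carrier G \<Longrightarrow> g \<otimes> z [^] \<phi> g = \<one> \<Longrightarrow> g = \<one>"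
  shows "z \<in> lower_central G n"
proof -
  have zG: "z \<in> carrier G" using z(1) by (rule centerD(1))
  have aut: "(\<lambda>g\<in>carrier G. g \<otimes> z [^] \<phi> g) \<in> Autcent G"
    using inj subgroup_int_pow_closed[OF subgroup_center z(1)]
    by (intro central_auto_of_hom[OF fin hom_pow_of_integer_mod_group[OF \<phi> zG z(2)]])
  have "inv q \<otimes> (\<lambda>g\<in>carrier G. g \<otimes> z [^] \<phi> g) q \<in> lower_central G n"
    by (rule Autc_commutator[OF n subsetD[OF sub aut] q(1)])
  moreover have "z [^] \<phi> q = z"
    using int_pow_mod[OF zG z(2), of 1] zG q(2) by simp
  ultimately show ?thesis
    using q(1) zG by (simp add: m_assoc[symmetric])
qed

section \<open>The argument for non-abelian \<open>p\<close>-groups\<close>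

locale nonabelian_p_group = group +
  fixes p n m :: nat
  assumes p: "prime p" and fin: "finite (carrier G)" and ord: "order G = p ^ m"
    and nonabelian: "\<not> comm_group G" and n: "2 \<le> n"
begin

lemma subgroup_derived_center: "subgroup (derived G (carrier G) <#> center G) G"
  using normal_imp_subgroup[OF normal_subgroup_set_mult_closed[OF derived_self_is_normal normal_center]] .

lemma derived_proper:
  assumes "lower_central G n \<subseteq> center G"
  shows "derived G (carrier G) <#> center G \<noteq> carrier G" "derived G (carrier G) \<noteq> carrier G"
proof -
  show "derived G (carrier G) <#> center G \<noteq> carrier G"
    using derived_center_proper[OF nonabelian n assms] by (simp add: lower_central_2)
  then show "derived G (carrier G) \<noteq> carrier G"
    using subset_set_mult(1)[OF normal_imp_subgroup[OF derived_self_is_normal] subgroup_center]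
      subgroup.subset[OF subgroup_derived_center] by auto
qed

text \<open>The character is chosen trivial on \<open>\<gamma>\<^sub>2 Z\<close>. An element with
  \<open>g \<otimes> z [^] \<phi> g = \<one>\<close> is central, so \<open>\<phi> g = 0\<close> and
  \<open>g = \<one>\<close>. Since \<open>\<gamma>\<^sub>2 Z \<noteq> G\<close>, the exponent
  \<open>k\<close> is positive, so \<open>p ^ k\<close> kills \<open>z\<close>.\<close>

lemma torsion_center_subset:
  assumes eq: "Autc G (n - 1) = Autcent G"
  shows "{z \<in> center G. z [^] p = \<one>} \<subseteq> lower_central G n"
proof
  fix z assume "z \<in> {z \<in> center G. z [^] p = \<one>}"
  then have z: "z \<in> center G" "z [^] p = \<one>" by auto
  let ?N = "derived G (carrier G) <#> center G"
  have sub: "derived G (carrier G) \<subseteq> ?N" "center G \<subseteq> ?N"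
    using subset_set_mult[OF normal_imp_subgroup[OF derived_self_is_normal] subgroup_center] by auto
  obtain k \<phi> q where \<phi>: "\<phi> \<in> hom G (integer_mod_group (p ^ k))" "\<And>x. x \<in> ?N \<Longrightarrow> \<phi> x = 0"
    and q: "q \<in> carrier G" "\<phi> q = 1 mod int (p ^ k)" and pow: "\<And>g. g \<in> carrier G \<Longrightarrow> g [^] (p ^ k) \<in> ?N"
    using quotient_character[OF p fin ord subgroup_derived_center sub(1)] by metis
  have central: "lower_central G n \<subseteq> center G"
    using eq by (intro lower_central_central_of_Autc[OF n]) simp
  have "k \<noteq> 0"
  proof
    assume "k = 0"
    then have "carrier G \<subseteq> ?N"
      using pow by (auto dest!: spec simp: nat_pow_eone)
    then show False
      using derived_proper(1)[OF central] subgroup.subset[OF subgroup_derived_center] by auto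
  qed
  then have "z [^] (p ^ k) = (z [^] p) [^] (p ^ (k - 1))"
    using centerD(1)[OF z(1)] by (simp add: nat_pow_pow flip: power_Suc)
  then have zk: "z [^] (p ^ k) = \<one>"
    using z(2) by simp
  show "z \<in> lower_central G n"
  proof (rule character_imp_lower_central[OF n fin _ z(1) zk \<phi>(1) q])
    show "Autcent G \<subseteq> Autc G (n - 1)" using eq by simp
    fix g assume g: "g \<in> carrier G" and one: "g \<otimes> z [^] \<phi> g = \<one>"
    have "z [^] \<phi> g \<in> center G"
      by (rule subgroup_int_pow_closed[OF subgroup_center z(1)])
    then have "inv (z [^] \<phi> g) \<in> center G"
      by (rule subgroup.m_inv_closed[OF subgroup_center])
    moreover have "g = inv (z [^] \<phi> g)"
      using inv_equality[OF one] g centerD(1)[OF z(1)] by simp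
    ultimately have "g \<in> ?N" using sub(2) by auto
    then show "g = \<one>"
      using one g \<phi>(2) by simp
  qed
qed

text \<open>Since \<open>\<Omega>\<^sub>1(Z) \<subseteq> \<gamma>\<^sub>n \<subseteq> \<gamma>\<^sub>2\<close>, the group has no abelian direct factor, so every
  homomorphism into the center gives a central automorphism.\<close>

lemma torsion_center_subset_exponent:
  assumes eq: "Autc G (n - 1) = Autcent G"
  obtains k where "exponent (G Mod lower_central G 2) \<le> p ^ k"
    "{z \<in> center G. z [^] (p ^ k) = \<one>} \<subseteq> lower_central G n"
proof -
  let ?N = "derived G (carrier G)"
  interpret N: normal ?N G by (rule derived_self_is_normal)
  obtain k \<phi> q where \<phi>: "\<phi> \<in> hom G (integer_mod_group (p ^ k))" "\<And>x. x \<in> ?N \<Longrightarrow> \<phi> x = 0"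
    and q: "q \<in> carrier G" "\<phi> q = 1 mod int (p ^ k)" and pow: "\<And>g. g \<in> carrier G \<Longrightarrow> g [^] (p ^ k) \<in> ?N"
    using quotient_character[OF p fin ord N.subgroup_axioms order_refl] by metis
  have exp: "exponent (G Mod lower_central G 2) \<le> p ^ k"
    unfolding lower_central_2
  proof (rule exponent_le)
    fix X assume "X \<in> carrier (G Mod ?N)"
    then obtain g where g: "g \<in> carrier G" "X = ?N #> g"
      by (auto simp: carrier_FactGroup)
    then show "X [^]\<^bsub>G Mod ?N\<^esub> (p ^ k) = \<one>\<^bsub>G Mod ?N\<^esub>"
      using coset_join2[OF _ N.subgroup_axioms pow[OF g(1)]] by (simp add: N.FactGroup_pow)
  qed (use prime_gt_0_nat[OF p] in simp)
  have "z \<in> lower_central G n" if z: "z \<in> center G" "z [^] (p ^ k) = \<one>" for z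
  proof (rule character_imp_lower_central[OF n fin _ z \<phi>(1) q])
    show "Autcent G \<subseteq> Autc G (n - 1)" using eq by simp
    have zG: "z \<in> carrier G" using z(1) by (rule centerD(1))
    interpret f: group_hom G G "\<lambda>g. z [^] \<phi> g"
      using hom_pow_of_integer_mod_group[OF \<phi>(1) zG z(2)]
      by (simp add: group_hom_def group_hom_axioms_def group_axioms)
    fix g assume g: "g \<in> carrier G" and one: "g \<otimes> z [^] \<phi> g = \<one>"
    show "g = \<one>"
    proof (rule ccontr)
      assume "g \<noteq> \<one>"
      obtain j where j: "ord g = p ^ j"
        using ord_dvd_group_order[OF g] divides_primepow_nat[OF p] by (auto simp: ord)
      have "j \<noteq> 0"
        using \<open>g \<noteq> \<one>\<close> j ord_eq_1[OF g] by auto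
      \<comment> \<open>A power of \<open>g\<close> of order \<open>p\<close>. As \<open>g\<close>
        turns out to be central, \<open>h\<close> lies in \<open>\<Omega>\<^sub>1(Z)\<close>, hence
        in \<open>\<gamma>\<^sub>2\<close>, where \<open>\<phi>\<close> vanishes. But
        \<open>z [^] \<phi> g = inv g\<close> gives \<open>z [^] \<phi> h = inv h\<close>, so
        \<open>h\<close> would be trivial.\<close>
      define h where "h = g [^] (p ^ (j - 1))"
      have h: "h \<in> carrier G" using g by (simp add: h_def)
      have "h [^] p = g [^] ord g"
        using g \<open>j \<noteq> 0\<close> by (simp add: h_def j nat_pow_pow mult.commute flip: power_Suc)
      then have hp: "h [^] p = \<one>"
        using g by simp
      have "\<not> p ^ j dvd p ^ (j - 1)"
        using \<open>j \<noteq> 0\<close> prime_gt_1_nat[OF p] by (auto dest: dvd_imp_le simp: power_increasing_iff)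
      then have "h \<noteq> \<one>"
        using g by (simp add: h_def pow_eq_id j)
      have zc: "z [^] \<phi> g \<in> center G"
        by (rule subgroup_int_pow_closed[OF subgroup_center z(1)])
      have "inv (z [^] \<phi> g) \<in> center G"
        using zc by (rule subgroup.m_inv_closed[OF subgroup_center])
      moreover have ginv: "g = inv (z [^] \<phi> g)"
        using inv_equality[OF one] g zG by simp
      ultimately have "g \<in> center G" by simp
      then have "h \<in> center G"
        using subgroup_int_pow_closed[OF subgroup_center, of g "int (p ^ (j - 1))"]
        by (simp only: h_def int_pow_int)
      then have "h \<in> lower_central G n"
        using torsion_center_subset[OF eq] hp by auto
      then have "h \<in> ?N"
        using lower_central_le_2[OF n] by (auto simp: lower_central_2)
      then have "\<phi> h = 0" by (rule \<phi>(2))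
      then have "z [^] \<phi> h = \<one>" by simp
      moreover have "z [^] \<phi> h = (z [^] \<phi> g) [^] (p ^ (j - 1))"
        using f.hom_nat_pow[OF g] by (simp add: h_def)
      moreover have "z [^] \<phi> g = inv g"
        using ginv zG by (metis inv_inv int_pow_closed)
      ultimately have "inv h = \<one>"
        using g by (simp add: h_def nat_pow_inv)
      then show False
        using \<open>h \<noteq> \<one>\<close> h by (metis inv_inv inv_one)
    qed
  qed
  then show thesis
    using that exp by blast
qed

lemma decomposition_of_center_subgroup:
  assumes "subgroup H G" "H \<subseteq> center G"
  shows "cyclic_decomposition p (G\<lparr>carrier := H\<rparr>) (cyclic_exponents p (G\<lparr>carrier := H\<rparr>))"
proof -
  obtain l where "card H = p ^ l"
    using subgroup_card_prime_power[OF p fin ord assms(1)] .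
  moreover have "comm_group (G\<lparr>carrier := H\<rparr>)"
  proof (rule group.group_comm_groupI[OF subgroup_imp_group[OF assms(1)]])
    fix x y assume "x \<in> carrier (G\<lparr>carrier := H\<rparr>)" "y \<in> carrier (G\<lparr>carrier := H\<rparr>)"
    then have "x \<otimes> y = y \<otimes> x"
      using assms by (intro centerD(2)) (auto dest: subgroup.mem_carrier)
    then show "x \<otimes>\<^bsub>G\<lparr>carrier := H\<rparr>\<^esub> y = y \<otimes>\<^bsub>G\<lparr>carrier := H\<rparr>\<^esub> x" by simp
  qed
  moreover have "finite H"
    using fin subgroup.subset[OF assms(1)] by (rule finite_subset[rotated])
  ultimately show ?thesis
    by (intro cyclic_decomposition_exponents[OF p]) auto
qed

text \<open>The rank counts cyclic factors, and their number is already visible in the elements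
  killed by \<open>p\<close>.\<close>

lemma rank_lower_central:
  assumes eq: "Autc G (n - 1) = Autcent G"
  shows "rank (G\<lparr>carrier := lower_central G n\<rparr>) = rank (G\<lparr>carrier := center G\<rparr>)"
proof -
  have central: "lower_central G n \<subseteq> center G"
    using eq by (intro lower_central_central_of_Autc[OF n]) simp
  show ?thesis
    using fin finite_subset[OF subgroup.subset[OF subgroup_center]] decomposition_of_center_subgroup
      subgroup_center lower_central_subgroup central torsion_center_subset[OF eq]
    by (intro subgroup_rank_eq[OF p]) auto
qed

lemma lower_central_eq_center:
  assumes eq: "Autc G (n - 1) = Autcent G"
    and exp: "var p G (lower_central G n) (center G) < exponent (G Mod lower_central G 2)"
  shows "lower_central G n = center G"
proof (rule ccontr)
  assume neq: "lower_central G n \<noteq> center G"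
  have central: "lower_central G n \<subseteq> center G"
    using eq by (intro lower_central_central_of_Autc[OF n]) simp
  obtain k where k: "exponent (G Mod lower_central G 2) \<le> p ^ k"
    "{z \<in> center G. z [^] (p ^ k) = \<one>} \<subseteq> lower_central G n"
    using torsion_center_subset_exponent[OF eq] .
  have "p ^ k \<le> var p G (lower_central G n) (center G)"
    using fin finite_subset[OF subgroup.subset[OF subgroup_center]] decomposition_of_center_subgroup
      subgroup_center lower_central_subgroup central torsion_center_subset[OF eq] k(2) neq
    by (intro exponent_le_var[OF p]) auto
  then show False using exp k(1) by simp
qed

lemma Autc_subset_Autcent:
  "lower_central G n = center G \<Longrightarrow> Autc G (n - 1) \<subseteq> Autcent G"
  using Autc_commutator[OF n] by (auto simp: Autcent_def Autc_def)

text \<open>Here the center lies in \<open>\<gamma>\<^sub>2\<close>, and the displacement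
  \<open>inv g \<otimes> \<alpha> g\<close>, a homomorphism with central values, is trivial
  there.\<close>

lemma Autcent_center:
  assumes "lower_central G n = center G" "\<alpha> \<in> Autcent G" "z \<in> center G"
  shows "\<alpha> z = z"
proof -
  have "z \<in> derived G (carrier G)"
    using assms(1,3) lower_central_le_2[OF n] by (auto simp: lower_central_2)
  then have "inv z \<otimes> \<alpha> z = \<one>"
    using assms(2) by (intro hom_center_derived[OF Autcent_hom[OF assms(2)]]) (auto simp: Autcent_def)
  moreover have "\<alpha> z \<in> carrier G" "z \<in> carrier G"
    using assms(2,3) by (auto simp: Autcent_def auto_def center_def hom_in_carrier)
  ultimately show ?thesis
    by (metis inv_closed inv_equality inv_inv)
qed

text \<open>One inclusion is clear, and both sides are isomorphic to the same group of
  homomorphisms, so they are finite sets of equal size.\<close>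

lemma Autc_eq_Autcent:
  assumes eq: "lower_central G n = center G"
    and iso: "(AutoGroup G)\<lparr>carrier := Autc G (n - 1)\<rparr> \<cong> Hom_group (G Mod center G) (G\<lparr>carrier := lower_central G n\<rparr>)"
  shows "Autc G (n - 1) = Autcent G"
proof (rule card_subset_eq)
  have "Autcent G \<subseteq> carrier G \<rightarrow>\<^sub>E carrier G"
  proof
    fix \<alpha> assume \<alpha>: "\<alpha> \<in> Autcent G"
    then have "\<alpha> \<in> hom G G" by (simp add: Autcent_def auto_def)
    then show "\<alpha> \<in> carrier G \<rightarrow>\<^sub>E carrier G"
      using Autcent_extensional[OF \<alpha>] by (simp add: PiE_iff hom_in_carrier)
  qed
  then show "finite (Autcent G)"
    by (rule finite_subset) (simp add: fin finite_PiE)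
  show "Autc G (n - 1) \<subseteq> Autcent G"
    by (rule Autc_subset_Autcent[OF eq])
  have "(AutoGroup G)\<lparr>carrier := Autcent G\<rparr> \<cong> Hom_group (G Mod center G) (G\<lparr>carrier := center G\<rparr>)"
    using Autcent_center[OF eq] by (intro Autcent_iso_Hom_group[OF fin])
  then show "card (Autc G (n - 1)) = card (Autcent G)"
    using iso_same_card[OF iso] eq by (auto dest: iso_same_card)
qed

text \<open>For equal subgroups \<open>var\<close> is 1 by convention, so the claim is that
  \<open>G / \<gamma>\<^sub>2\<close> is nontrivial. That holds because
  \<open>\<gamma>\<^sub>n\<close> is central and \<open>G\<close> is not abelian.\<close>

lemma exponent_gt_var:
  assumes "lower_central G n = center G"
  shows "var p G (lower_central G n) (center G) < exponent (G Mod lower_central G 2)"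
proof -
  let ?N = "derived G (carrier G)"
  interpret N: normal ?N G by (rule derived_self_is_normal)
  interpret Q: group "G Mod ?N" by (rule N.factorgroup_is_group)
  have finQ: "finite (carrier (G Mod ?N))"
    using fin by (simp add: carrier_FactGroup)
  have "exponent (G Mod ?N) \<noteq> 1"
  proof
    assume 1: "exponent (G Mod ?N) = 1"
    have "g \<in> ?N" if g: "g \<in> carrier G" for g
    proof -
      have c: "?N #> g \<in> carrier (G Mod ?N)"
        using g by (auto simp: carrier_FactGroup)
      then have "?N #> g = ?N"
        using exponent_properties(2)[OF Q.group_axioms finQ c] Q.nat_pow_eone[OF c]
        unfolding 1 one_FactGroup by metis
      then show ?thesis
        using g by (intro coset_join1[OF _ _ N.subgroup_axioms])
    qed
    then show False
      using derived_proper(2) assms N.subset by auto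
  qed
  moreover have "0 < exponent (G Mod ?N)"
    by (rule exponent_properties(1)[OF Q.group_axioms finQ])
  ultimately show ?thesis
    using assms by (simp add: var_def lower_central_2)
qed

end

theorem theorem4p1:
  fixes G :: "('a, 'b) monoid_scheme" and p n :: nat
  assumes "prime p" and "p_group p G" and "\<not> comm_group G" and "2 \<le> n"
  shows
    "(Autc G (n - 1) = Autcent G \<longrightarrow>
        (lower_central G n \<subseteq> center G \<and>
         rank (G\<lparr>carrier := lower_central G n\<rparr>) = rank (G\<lparr>carrier := center G\<rparr>)) \<and>
        (exponent (G Mod lower_central G 2) > var p G (lower_central G n) (center G) \<longrightarrow>
           lower_central G n = center G \<and>
           (AutoGroup G)\<lparr>carrier := Autc G (n - 1)\<rparr> \<cong>
             Hom_group (G Mod center G) (G\<lparr>carrier := lower_central G n\<rparr>))) \<and>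
     (lower_central G n = center G \<and>
      (AutoGroup G)\<lparr>carrier := Autc G (n - 1)\<rparr> \<cong>
        Hom_group (G Mod center G) (G\<lparr>carrier := lower_central G n\<rparr>) \<longrightarrow>
        Autc G (n - 1) = Autcent G \<and>
        exponent (G Mod lower_central G 2) > var p G (lower_central G n) (center G))"
proof -
  obtain m where "order G = p ^ m" "finite (carrier G)" "group G"
    using assms(2) by (auto simp: p_group_def)
  then interpret nonabelian_p_group G p n m
    using assms by (simp add: nonabelian_p_group_def nonabelian_p_group_axioms_def)
  show ?thesis
  proof (intro conjI impI)
    assume eq: "Autc G (n - 1) = Autcent G"
    then show "lower_central G n \<subseteq> center G"
      by (intro lower_central_central_of_Autc[OF n]) simp
    show "rank (G\<lparr>carrier := lower_central G n\<rparr>) = rank (G\<lparr>carrier := center G\<rparr>)"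
      by (rule rank_lower_central[OF eq])
    assume "exponent (G Mod lower_central G 2) > var p G (lower_central G n) (center G)"
    then show Z: "lower_central G n = center G"
      by (rule lower_central_eq_center[OF eq])
    show "(AutoGroup G)\<lparr>carrier := Autc G (n - 1)\<rparr> \<cong>
        Hom_group (G Mod center G) (G\<lparr>carrier := lower_central G n\<rparr>)"
      unfolding eq Z using Autcent_center[OF Z] by (intro Autcent_iso_Hom_group[OF fin])
  next
    assume *: "lower_central G n = center G \<and>
      (AutoGroup G)\<lparr>carrier := Autc G (n - 1)\<rparr> \<cong>
        Hom_group (G Mod center G) (G\<lparr>carrier := lower_central G n\<rparr>)"
    show "Autc G (n - 1) = Autcent G"
      by (rule Autc_eq_Autcent[OF conjunct1[OF *] conjunct2[OF *]])
    show "exponent (G Mod lower_central G 2) > var p G (lower_central G n) (center G)"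
      by (rule exponent_gt_var[OF conjunct1[OF *]])
  qed
qed

end
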